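(* Let $k$ be a field of characteristic $0$, let $a,b\in k$ with $a\neq 0$ be such that $h(x)=x^3+ax+b$ is irreducible over $k$, and let $K=k(\alpha)$ where $\alpha^3+a\alpha+b=0$. Let $f(t)=t^6+a_4t^4+a_1t+a_0\in k[t]$ with $a_1a_4\neq 0$. Then the variety $\mathcal{S}_f\subset\mathbb{A}^4$ defined by \[ N_{K/k}(X_1+\alpha X_2+\alpha^2X_3)=f(t) \] is $k$-unirational.
   Context: Here $N_{K/k}$ is the field norm, so $N_{K/k}(X_1+\alpha X_2+\alpha^2X_3)$ is the cubic form $X_{1}^3- bX_{2}^3+ b^2X_{3}^3 + (aX_{2}+3bX_{3})X_{1}X_{2}-(2aX_{1}^2-a^2X_{1}X_{3}-abX_{2}X_{3})X_{3}$ in $k[X_1,X_2,X_3]$. A variety over $k$ is $k$-unirational if there is a dominant rational map defined over $k$ from some affine space $\mathbb{A}^n_k$ to it. *)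

theory Defs
  imports
    "HOL-Library.Poly_Mapping"
    "HOL-Algebra.Generated_Fields"
    "HOL-Algebra.Algebraic_Closure_Type"
    "Jordan_Normal_Form.Determinant"
begin

text \<open>
  Multivariate polynomials in the variables \<open>X\<^sub>0, X\<^sub>1, \<dots>\<close> are finitely supported functions on
  monomials, and a monomial is a finitely supported exponent function. The points of the affine
  space \<open>A\<^sup>n\<close> are vectors in \<^term>\<open>carrier_vec n\<close> over an algebraic closure of the ground field.
\<close>

no_notation fps_nth (infixl "$" 75)

type_synonym 'a mpoly = "(nat \<Rightarrow>\<^sub>0 nat) \<Rightarrow>\<^sub>0 'a"

definition mconst :: "'a::zero \<Rightarrow> 'a mpoly"
  where "mconst c = Poly_Mapping.single 0 c"

definition mvar :: "nat \<Rightarrow> 'a::zero_neq_one mpoly"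
  where "mvar i = Poly_Mapping.single (Poly_Mapping.single i 1) 1"

definition mpolys :: "nat \<Rightarrow> 'a::zero mpoly set"
  where "mpolys n = {p. \<forall>m \<in> Poly_Mapping.keys p. Poly_Mapping.keys m \<subseteq> {..<n}}"

text \<open>Evaluation at \<open>x\<close>, where \<open>\<phi>\<close> embeds the ring of coefficients into the ring of coordinates.\<close>

definition mpoly_eval :: "('a::zero \<Rightarrow> 'b::comm_semiring_1) \<Rightarrow> 'b vec \<Rightarrow> 'a mpoly \<Rightarrow> 'b"
  where "mpoly_eval \<phi> x p =
    (\<Sum>m\<in>Poly_Mapping.keys p. \<phi> (Poly_Mapping.lookup p m) *
      (\<Prod>i\<in>Poly_Mapping.keys m. (x $ i) ^ Poly_Mapping.lookup m i))"

definition zero_locus :: "('a::zero \<Rightarrow> 'b::comm_semiring_1) \<Rightarrow> nat \<Rightarrow> 'a mpoly set \<Rightarrow> 'b vec set"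
  where "zero_locus \<phi> n S = {x \<in> carrier_vec n. \<forall>p\<in>S. mpoly_eval \<phi> x p = 0}"

definition zariski_closed :: "nat \<Rightarrow> 'b::field vec set \<Rightarrow> bool"
  where "zariski_closed n Z \<longleftrightarrow> (\<exists>S \<subseteq> mpolys n. Z = zero_locus (\<lambda>c. c) n S)"

definition zariski_closure :: "nat \<Rightarrow> 'b::field vec set \<Rightarrow> 'b vec set"
  where "zariski_closure n A = \<Inter>{Z. zariski_closed n Z \<and> A \<subseteq> Z}"

text \<open>
  A rational map from \<open>A\<^sup>n\<close> to \<open>A\<^sup>m\<close> over \<open>k\<close> is given by \<open>m\<close> fractions of polynomials in \<open>n\<close> variables
  over \<open>k\<close>. It is evaluated where none of the denominators vanishes. This dense open subset of \<open>A\<^sup>n\<close>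
  may depend on the chosen fractions, but the closure of its image does not.
\<close>

definition is_rational_map :: "nat \<Rightarrow> nat \<Rightarrow> ('a::zero mpoly \<times> 'a mpoly) list \<Rightarrow> bool"
  where "is_rational_map n m F \<longleftrightarrow>
    length F = m \<and> (\<forall>(p, q) \<in> set F. p \<in> mpolys n \<and> q \<in> mpolys n \<and> q \<noteq> 0)"

definition ratmap_domain :: "nat \<Rightarrow> ('a::field mpoly \<times> 'a mpoly) list \<Rightarrow> 'a alg_closure vec set"
  where "ratmap_domain n F = {u \<in> carrier_vec n. \<forall>(p, q) \<in> set F. mpoly_eval to_ac u q \<noteq> 0}"

definition ratmap_apply ::
    "('a::field mpoly \<times> 'a mpoly) list \<Rightarrow> 'a alg_closure vec \<Rightarrow> 'a alg_closure vec"
  where "ratmap_apply F u =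
    vec_of_list (map (\<lambda>(p, q). mpoly_eval to_ac u p / mpoly_eval to_ac u q) F)"

text \<open>
  A subvariety \<open>V\<close> of \<open>A\<^sup>m\<close> is represented by its set of geometric points; the ground field \<open>k\<close> is
  the type parameter.
\<close>

definition dominant_ratmap ::
    "nat \<Rightarrow> nat \<Rightarrow> 'a::field alg_closure vec set \<Rightarrow> ('a mpoly \<times> 'a mpoly) list \<Rightarrow> bool"
  where "dominant_ratmap n m V F \<longleftrightarrow>
    is_rational_map n m F \<and>
    ratmap_apply F ` ratmap_domain n F \<subseteq> V \<and>
    V \<subseteq> zariski_closure m (ratmap_apply F ` ratmap_domain n F)"

definition unirational :: "nat \<Rightarrow> 'a::field alg_closure vec set \<Rightarrow> bool"
  where "unirational m V \<longleftrightarrow> (\<exists>n F. dominant_ratmap n m V F)"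

text \<open>Finite extensions \<open>K\<close> of \<open>k\<close> are taken inside the algebraic closure of \<open>k\<close>.\<close>

definition adjoin :: "'a::field alg_closure \<Rightarrow> 'a alg_closure set"
  where "adjoin \<alpha> = generate_field ring_of_type_algebra (insert \<alpha> (range to_ac))"

interpretation ac_vs: vector_space "\<lambda>(c::'a::field) v. to_ac c * v"
  by standard (simp_all add: algebra_simps)

definition is_basis :: "'a::field alg_closure set \<Rightarrow> 'a alg_closure list \<Rightarrow> bool"
  where "is_basis K bs \<longleftrightarrow>
    distinct bs \<and> ac_vs.independent (set bs) \<and> ac_vs.span (set bs) = K"

definition some_basis :: "'a::field alg_closure set \<Rightarrow> 'a alg_closure list"
  where "some_basis K = (SOME bs. is_basis K bs)"

definition mult_matrix :: "'a::field alg_closure list \<Rightarrow> 'a alg_closure \<Rightarrow> 'a mat"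
  where "mult_matrix bs \<beta> = mat (length bs) (length bs)
    (\<lambda>(i, j). ac_vs.representation (set bs) (\<beta> * bs ! j) (bs ! i))"

text \<open>The field norm of \<open>K/k\<close>: the determinant of multiplication by \<open>\<beta>\<close> on the \<open>k\<close>-space \<open>K\<close>.\<close>

definition field_norm :: "'a::field alg_closure set \<Rightarrow> 'a alg_closure \<Rightarrow> 'a"
  where "field_norm K \<beta> = det (mult_matrix (some_basis K) \<beta>)"

text \<open>
  The polynomial \<open>N(X\<^sub>0 \<omega>\<^sub>0 + \<dots> + X\<^sub>r \<omega>\<^sub>r)\<close>, where \<open>N\<close> is the norm of \<open>K/k\<close> extended to \<open>K[X]/k[X]\<close>:
  multiplication by \<open>X\<^sub>0 \<omega>\<^sub>0 + \<dots> + X\<^sub>r \<omega>\<^sub>r\<close> has the matrix \<open>X\<^sub>0 M\<^sub>0 + \<dots> + X\<^sub>r M\<^sub>r\<close> with respect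
  to a \<open>k\<close>-basis of \<open>K\<close>, where \<open>M\<^sub>l\<close> is the matrix of multiplication by \<open>\<omega>\<^sub>l\<close> on \<open>K\<close>.
\<close>

definition generic_mult_matrix ::
    "'a::field alg_closure list \<Rightarrow> 'a alg_closure list \<Rightarrow> 'a mpoly mat"
  where "generic_mult_matrix bs \<omega>s = mat (length bs) (length bs)
    (\<lambda>(i, j). \<Sum>l<length \<omega>s. mvar l * mconst (mult_matrix bs (\<omega>s ! l) $$ (i, j)))"

definition norm_form :: "'a::field alg_closure set \<Rightarrow> 'a alg_closure list \<Rightarrow> 'a mpoly"
  where "norm_form K \<omega>s = det (generic_mult_matrix (some_basis K) \<omega>s)"

text \<open>
  The hypersurface \<open>N(X\<^sub>1 + \<alpha> X\<^sub>2 + \<alpha>\<^sup>2 X\<^sub>3) = f(t)\<close> of \<open>A\<^sup>4\<close>, where \<open>N\<close> is the norm of \<open>K/k\<close>. The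
  variables \<open>X\<^sub>1, X\<^sub>2, X\<^sub>3, t\<close> have the indices 0, 1, 2, 3.
\<close>

definition norm_hypersurface ::
    "'a::field alg_closure set \<Rightarrow> 'a alg_closure \<Rightarrow> 'a poly \<Rightarrow> 'a alg_closure vec set"
  where "norm_hypersurface K \<alpha> f =
    zero_locus to_ac 4 {norm_form K [1, \<alpha>, \<alpha>\<^sup>2] - poly (map_poly mconst f) (mvar 3)}"


subsection \<open>Agreement of the norm form with the field norm and with the explicit cubic form\<close>

lemma mpoly_eval_superset:
  assumes "finite A" "Poly_Mapping.keys p \<subseteq> A" "\<phi> 0 = 0"
  shows "mpoly_eval \<phi> x p = (\<Sum>m\<in>A. \<phi> (Poly_Mapping.lookup p m) *
      (\<Prod>i\<in>Poly_Mapping.keys m. (x $ i) ^ Poly_Mapping.lookup m i))"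
  unfolding mpoly_eval_def using assms
  by (intro sum.mono_neutral_left) (auto simp: in_keys_iff)

lemma mpoly_eval_add:
  assumes "\<phi> 0 = 0" "\<And>a b. \<phi> (a + b) = \<phi> a + \<phi> b"
  shows "mpoly_eval \<phi> x (p + q) = mpoly_eval \<phi> x p + mpoly_eval \<phi> x q"
proof -
  let ?A = "Poly_Mapping.keys p \<union> Poly_Mapping.keys q"
  have "Poly_Mapping.keys (p + q) \<subseteq> ?A"
    by (rule keys_add)
  then show ?thesis
    using mpoly_eval_superset[of ?A p \<phi> x] mpoly_eval_superset[of ?A q \<phi> x]
      mpoly_eval_superset[of ?A "p + q" \<phi> x] assms
    by (simp add: lookup_add distrib_right sum.distrib)
qed

lemma mpoly_eval_0: "mpoly_eval \<phi> x 0 = 0"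
  by (simp add: mpoly_eval_def)

lemma mpoly_eval_single:
  "\<phi> 0 = 0 \<Longrightarrow> mpoly_eval \<phi> x (Poly_Mapping.single m c) =
    \<phi> c * (\<Prod>i\<in>Poly_Mapping.keys m. (x $ i) ^ Poly_Mapping.lookup m i)"
  by (simp add: mpoly_eval_def)

lemma mpoly_eval_sum:
  assumes "\<phi> 0 = 0" "\<And>a b. \<phi> (a + b) = \<phi> a + \<phi> b"
  shows "mpoly_eval \<phi> x (sum g A) = (\<Sum>i\<in>A. mpoly_eval \<phi> x (g i))"
  by (induction A rule: infinite_finite_induct)
    (simp_all add: mpoly_eval_0 mpoly_eval_add[of \<phi>] assms)

lemma mpoly_sum_singles:
  fixes p :: "'a::comm_monoid_add mpoly"
  shows "p = (\<Sum>m\<in>Poly_Mapping.keys p. Poly_Mapping.single m (Poly_Mapping.lookup p m))"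
  by (rule poly_mapping_eqI)
    (auto simp: lookup_sum lookup_single when_def sum.delta' in_keys_iff)

lemma monomial_add:
  fixes x :: "'b::comm_semiring_1 vec" and m m' :: "nat \<Rightarrow>\<^sub>0 nat"
  shows "(\<Prod>i\<in>Poly_Mapping.keys (m + m'). (x $ i) ^ Poly_Mapping.lookup (m + m') i) =
    (\<Prod>i\<in>Poly_Mapping.keys m. (x $ i) ^ Poly_Mapping.lookup m i) *
    (\<Prod>i\<in>Poly_Mapping.keys m'. (x $ i) ^ Poly_Mapping.lookup m' i)"
proof -
  let ?A = "Poly_Mapping.keys m \<union> Poly_Mapping.keys m'"
  have *: "(\<Prod>i\<in>Poly_Mapping.keys r. (x $ i) ^ Poly_Mapping.lookup r i) =
      (\<Prod>i\<in>?A. (x $ i) ^ Poly_Mapping.lookup r i)"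
    if "Poly_Mapping.keys r \<subseteq> ?A" for r :: "nat \<Rightarrow>\<^sub>0 nat"
    using that by (intro prod.mono_neutral_left) (auto simp: in_keys_iff)
  show ?thesis
    using *[of m] *[of m'] *[of "m + m'"] keys_add[of m m']
    by (simp add: lookup_add power_add prod.distrib)
qed

lemma mpoly_eval_mult:
  fixes p q :: "'a::comm_semiring_1 mpoly"
  assumes "\<phi> 0 = 0" "\<And>a b. \<phi> (a + b) = \<phi> a + \<phi> b" "\<And>a b. \<phi> (a * b) = \<phi> a * \<phi> b"
  shows "mpoly_eval \<phi> x (p * q) = mpoly_eval \<phi> x p * mpoly_eval \<phi> x q"
proof -
  let ?s = "\<lambda>p m. Poly_Mapping.single m (Poly_Mapping.lookup p m) :: 'a mpoly"
  have "p * q = (\<Sum>m\<in>Poly_Mapping.keys p. ?s p m) * (\<Sum>m\<in>Poly_Mapping.keys q. ?s q m)"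
    by (simp flip: mpoly_sum_singles)
  also have "mpoly_eval \<phi> x \<dots> =
      (\<Sum>m\<in>Poly_Mapping.keys p. \<Sum>m'\<in>Poly_Mapping.keys q. mpoly_eval \<phi> x (?s p m * ?s q m'))"
    by (simp add: sum_product mpoly_eval_sum[of \<phi>, OF assms(1,2)])
  also have "\<dots> = (\<Sum>m\<in>Poly_Mapping.keys p. \<Sum>m'\<in>Poly_Mapping.keys q.
      mpoly_eval \<phi> x (?s p m) * mpoly_eval \<phi> x (?s q m'))"
    by (simp add: mult_single mpoly_eval_single[of \<phi>, OF assms(1)] monomial_add assms(3) mult_ac)
  also have "\<dots> = mpoly_eval \<phi> x (\<Sum>m\<in>Poly_Mapping.keys p. ?s p m) *
      mpoly_eval \<phi> x (\<Sum>m\<in>Poly_Mapping.keys q. ?s q m)"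
    by (simp add: sum_product mpoly_eval_sum[of \<phi>, OF assms(1,2)])
  finally show ?thesis
    by (simp flip: mpoly_sum_singles)
qed

lemma mpoly_eval_mconst: "\<phi> 0 = 0 \<Longrightarrow> mpoly_eval \<phi> x (mconst c) = \<phi> c"
  by (simp add: mconst_def mpoly_eval_single)

lemma mpoly_eval_mvar: "\<phi> 0 = 0 \<Longrightarrow> \<phi> 1 = 1 \<Longrightarrow> mpoly_eval \<phi> x (mvar i) = x $ i"
  by (simp add: mvar_def mpoly_eval_single)

lemma comm_ring_hom_mpoly_eval:
  fixes \<phi> :: "'a::comm_ring_1 \<Rightarrow> 'b::comm_ring_1"
  assumes "comm_ring_hom \<phi>"
  shows "comm_ring_hom (mpoly_eval \<phi> x)"
proof -
  interpret comm_ring_hom \<phi> by fact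
  have "mpoly_eval \<phi> x 1 = 1"
    using mpoly_eval_mconst[of \<phi> x 1] by (simp add: mconst_def)
  then show ?thesis
    by unfold_locales
      (simp_all add: mpoly_eval_0 mpoly_eval_add mpoly_eval_mult hom_add hom_mult)
qed

lemma mconst_simps:
  "mconst 0 = 0" "mconst 1 = 1" "mconst (a + b) = mconst a + mconst b"
  "mconst (a * b) = mconst a * mconst b" for a b :: "'a::comm_ring_1"
  by (simp_all add: mconst_def single_add mult_single)

lemma mconst_sum: "mconst (sum g A) = (\<Sum>i\<in>A. mconst (g i :: 'a::comm_ring_1))"
  by (induction A rule: infinite_finite_induct) (simp_all add: mconst_simps)

lemma subfield_adjoin: "subfield (adjoin \<alpha>) ring_of_type_algebra"
  unfolding adjoin_def
  by (rule Generated_Fields.field.generate_field_is_subfield[OF field_from_type_algebra])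
    (simp add: ring_of_type_algebra_def)

lemma adjoin_mult: "x \<in> adjoin \<alpha> \<Longrightarrow> y \<in> adjoin \<alpha> \<Longrightarrow> x * y \<in> adjoin \<alpha>"
  unfolding adjoin_def using generate_field.eng_mult[of x ring_of_type_algebra _ y]
  by (simp add: ring_of_type_algebra_def)

lemma adjoin_add: "x \<in> adjoin \<alpha> \<Longrightarrow> y \<in> adjoin \<alpha> \<Longrightarrow> x + y \<in> adjoin \<alpha>"
  unfolding adjoin_def using generate_field.eng_add[of x ring_of_type_algebra _ y]
  by (simp add: ring_of_type_algebra_def)

lemma adjoin_incl: "\<alpha> \<in> adjoin \<alpha>" "to_ac c \<in> adjoin \<alpha>"
  unfolding adjoin_def by (auto intro: generate_field.incl)

lemma basis_sum:
  assumes "is_basis K bs" "v \<in> K"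
  shows "(\<Sum>k<length bs. to_ac (ac_vs.representation (set bs) v (bs ! k)) * (bs ! k)) = v"
proof -
  have "(\<Sum>b\<in>set bs. to_ac (ac_vs.representation (set bs) v b) * b) = v"
    using assms by (intro ac_vs.sum_representation_eq) (auto simp: is_basis_def)
  moreover have "bij_betw ((!) bs) {..<length bs} (set bs)"
    using assms(1) by (intro bij_betw_nth) (auto simp: is_basis_def)
  from sum.reindex_bij_betw[OF this,
      of "\<lambda>b. to_ac (ac_vs.representation (set bs) v b) * b"]
  have "(\<Sum>k<length bs. to_ac (ac_vs.representation (set bs) v (bs ! k)) * (bs ! k)) =
    (\<Sum>b\<in>set bs. to_ac (ac_vs.representation (set bs) v b) * b)" .
  ultimately show ?thesis by (rule trans[rotated])
qed

lemma is_basis_subset: "is_basis K bs \<Longrightarrow> set bs \<subseteq> K"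
  unfolding is_basis_def using ac_vs.span_superset by blast

lemma representation_linear:
  assumes "is_basis K bs" "\<And>k. k \<in> A \<Longrightarrow> v k \<in> K"
  shows "ac_vs.representation (set bs) (\<Sum>k\<in>A. to_ac (c k) * v k) b =
    (\<Sum>k\<in>A. c k * ac_vs.representation (set bs) (v k) b)"
  using assms
  by (subst ac_vs.representation_sum)
    (auto simp: is_basis_def ac_vs.representation_scale intro!: ac_vs.span_scale)

lemma representation_change:
  assumes "is_basis K bs" "is_basis K cs" "v \<in> K"
  shows "ac_vs.representation (set bs) v b =
    (\<Sum>k<length cs. ac_vs.representation (set cs) v (cs ! k) * ac_vs.representation (set bs) (cs ! k) b)"
proof -
  have "cs ! k \<in> K" if "k \<in> {..<length cs}" for k
    using that is_basis_subset[OF assms(2)] by auto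
  then have "ac_vs.representation (set bs)
      (\<Sum>k<length cs. to_ac (ac_vs.representation (set cs) v (cs ! k)) * cs ! k) b =
    (\<Sum>k<length cs. ac_vs.representation (set cs) v (cs ! k) * ac_vs.representation (set bs) (cs ! k) b)"
    by (rule representation_linear[OF assms(1)])
  then show ?thesis
    unfolding basis_sum[OF assms(2,3)] .
qed

lemma length_basis_eq:
  assumes "is_basis K bs" "is_basis K cs"
  shows "length bs = length cs"
proof -
  have "ac_vs.dim K = length cs" if "is_basis K cs" for cs
    using that ac_vs.dim_eq_card[of "set cs" K] ac_vs.span_span[of "set cs"]
      distinct_card[of cs]
    unfolding is_basis_def by metis
  from this[OF assms(1)] this[OF assms(2)] show ?thesis by simp
qed

lemma representation_nth:
  assumes "is_basis K bs" "i < length bs" "j < length bs"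
  shows "ac_vs.representation (set bs) (bs ! j) (bs ! i) = (if i = j then 1 else 0)"
  using assms by (auto simp: is_basis_def ac_vs.representation_basis nth_eq_iff_index_eq)

lemma det_generic_mult_matrix_change:
  assumes bs: "is_basis K bs" and cs: "is_basis K cs" and \<omega>s: "set \<omega>s \<subseteq> K"
    and mult: "\<And>x y. x \<in> K \<Longrightarrow> y \<in> K \<Longrightarrow> x * y \<in> K"
  shows "det (generic_mult_matrix bs \<omega>s) = det (generic_mult_matrix cs \<omega>s)"
proof -
  define d where "d = length bs"
  have d: "length bs = d" "length cs = d"
    using length_basis_eq[OF bs cs] by (simp_all add: d_def)
  have in_K: "bs ! i \<in> K" "cs ! i \<in> K" if "i < d" for i
    using that d is_basis_subset[OF bs] is_basis_subset[OF cs] by auto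
  have in_K': "\<omega>s ! l \<in> K" if "l < length \<omega>s" for l
    using that \<omega>s by auto
  define T where "T bs cs = mat d d (\<lambda>(i, j).
    mconst (ac_vs.representation (set bs) (cs ! j) (bs ! i)))" for bs cs :: "'a alg_closure list"
  have TT: "T bs cs * T cs bs = 1\<^sub>m d"
  proof (rule eq_matI)
    fix i j assume "i < dim_row (1\<^sub>m d :: 'a mpoly mat)" "j < dim_col (1\<^sub>m d :: 'a mpoly mat)"
    then have ij: "i < d" "j < d" by simp_all
    have "(T bs cs * T cs bs) $$ (i, j) = mconst (\<Sum>k<d.
      ac_vs.representation (set cs) (bs ! j) (cs ! k) * ac_vs.representation (set bs) (cs ! k) (bs ! i))"
      using ij by (simp add: T_def scalar_prod_def mconst_sum mconst_simps lessThan_atLeast0 mult.commute)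
    also have "\<dots> = mconst (ac_vs.representation (set bs) (bs ! j) (bs ! i))"
      using representation_change[OF bs cs in_K(1)[OF ij(2)], of "bs ! i"] d by simp
    finally show "(T bs cs * T cs bs) $$ (i, j) = 1\<^sub>m d $$ (i, j)"
      using representation_nth[OF bs, of i j] ij d by (simp add: mconst_simps)
  qed (simp_all add: T_def)
  have comm: "T bs cs * generic_mult_matrix cs \<omega>s = generic_mult_matrix bs \<omega>s * T bs cs"
  proof (rule eq_matI)
    fix i j
    assume "i < dim_row (generic_mult_matrix bs \<omega>s * T bs cs)"
      "j < dim_col (generic_mult_matrix bs \<omega>s * T bs cs)"
    then have ij: "i < d" "j < d" by (simp_all add: generic_mult_matrix_def T_def d)
    let ?r = "\<lambda>l. ac_vs.representation (set bs) (\<omega>s ! l * cs ! j) (bs ! i)"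
    have 1: "?r l = (\<Sum>k<d. ac_vs.representation (set bs) (cs ! k) (bs ! i) *
        ac_vs.representation (set cs) (\<omega>s ! l * cs ! j) (cs ! k))" if l: "l < length \<omega>s" for l
      using representation_change[OF bs cs mult[OF in_K'[OF l] in_K(2)[OF ij(2)]], of "bs ! i"] d
      by (simp add: mult.commute)
    have 2: "?r l = (\<Sum>k<d. ac_vs.representation (set bs) (\<omega>s ! l * bs ! k) (bs ! i) *
        ac_vs.representation (set bs) (cs ! j) (bs ! k))" if l: "l < length \<omega>s" for l
    proof -
      have "\<omega>s ! l * cs ! j = (\<Sum>k<d. to_ac (ac_vs.representation (set bs) (cs ! j) (bs ! k)) * (\<omega>s ! l * bs ! k))"
        by (subst basis_sum[OF bs in_K(2)[OF ij(2)], symmetric])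
          (simp add: d sum_distrib_left mult_ac)
      then have "?r l = (\<Sum>k<d. ac_vs.representation (set bs) (cs ! j) (bs ! k) *
          ac_vs.representation (set bs) (\<omega>s ! l * bs ! k) (bs ! i))"
        using representation_linear[OF bs, of "{..<d}" "\<lambda>k. \<omega>s ! l * bs ! k"] mult in_K in_K'[OF l]
        by simp
      then show ?thesis by (simp add: mult.commute)
    qed
    have "(T bs cs * generic_mult_matrix cs \<omega>s) $$ (i, j) =
        (\<Sum>k<d. mconst (ac_vs.representation (set bs) (cs ! k) (bs ! i)) *
          (\<Sum>l<length \<omega>s. mvar l * mconst (ac_vs.representation (set cs) (\<omega>s ! l * cs ! j) (cs ! k))))"
      using ij by (simp add: T_def generic_mult_matrix_def mult_matrix_def d scalar_prod_def lessThan_atLeast0)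
    also have "\<dots> = (\<Sum>l<length \<omega>s. \<Sum>k<d. mvar l *
          mconst (ac_vs.representation (set bs) (cs ! k) (bs ! i) *
            ac_vs.representation (set cs) (\<omega>s ! l * cs ! j) (cs ! k)))"
      unfolding sum_distrib_left by (subst sum.swap) (simp only: mconst_simps mult_ac)
    also have "\<dots> = (\<Sum>l<length \<omega>s. mvar l * mconst (?r l))"
      by (intro sum.cong refl) (simp add: 1 mconst_sum sum_distrib_left)
    also have "\<dots> = (\<Sum>l<length \<omega>s. \<Sum>k<d. mvar l *
          mconst (ac_vs.representation (set bs) (\<omega>s ! l * bs ! k) (bs ! i) *
            ac_vs.representation (set bs) (cs ! j) (bs ! k)))"
      by (intro sum.cong refl) (simp add: 2 mconst_sum sum_distrib_left)
    also have "\<dots> = (\<Sum>k<d. (\<Sum>l<length \<omega>s. mvar l *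
          mconst (ac_vs.representation (set bs) (\<omega>s ! l * bs ! k) (bs ! i))) *
            mconst (ac_vs.representation (set bs) (cs ! j) (bs ! k)))"
      unfolding sum_distrib_right by (subst sum.swap) (simp only: mconst_simps mult_ac)
    also have "\<dots> = (generic_mult_matrix bs \<omega>s * T bs cs) $$ (i, j)"
      using ij by (simp add: T_def generic_mult_matrix_def mult_matrix_def d scalar_prod_def lessThan_atLeast0)
    finally show "(T bs cs * generic_mult_matrix cs \<omega>s) $$ (i, j) =
      (generic_mult_matrix bs \<omega>s * T bs cs) $$ (i, j)" .
  qed (simp_all add: T_def generic_mult_matrix_def d)
  have carr: "T bs cs \<in> carrier_mat d d" "T cs bs \<in> carrier_mat d d"
    "generic_mult_matrix bs \<omega>s \<in> carrier_mat d d" "generic_mult_matrix cs \<omega>s \<in> carrier_mat d d"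
    by (simp_all add: T_def generic_mult_matrix_def d)
  have one: "det (T bs cs) * det (T cs bs) = 1"
    using det_mult[OF carr(1,2)] TT by simp
  have eq: "det (T bs cs) * det (generic_mult_matrix cs \<omega>s) = det (generic_mult_matrix bs \<omega>s) * det (T bs cs)"
    using arg_cong[OF comm, of det] by (simp add: det_mult[OF carr(1,4)] det_mult[OF carr(3,1)])
  have "(det (T bs cs) * det (T cs bs)) * det (generic_mult_matrix cs \<omega>s) =
      det (T cs bs) * (det (T bs cs) * det (generic_mult_matrix cs \<omega>s))"
    by (simp only: mult_ac)
  also have "\<dots> = (det (T bs cs) * det (T cs bs)) * det (generic_mult_matrix bs \<omega>s)"
    unfolding eq by (simp only: mult_ac)
  finally show ?thesis by (simp add: one)
qed

lemma norm_form_eq_basis: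
  assumes "is_basis K bs" "set \<omega>s \<subseteq> K" "\<And>x y. x \<in> K \<Longrightarrow> y \<in> K \<Longrightarrow> x * y \<in> K"
  shows "norm_form K \<omega>s = det (generic_mult_matrix bs \<omega>s)"
proof -
  have "is_basis K (some_basis K)"
    unfolding some_basis_def using assms(1) by (rule someI)
  from det_generic_mult_matrix_change[OF this assms] show ?thesis
    by (simp add: norm_form_def)
qed

lemma mpoly_eval_norm_form:
  assumes K: "is_basis K bs" "set \<omega>s \<subseteq> K" "\<And>x y. x \<in> K \<Longrightarrow> y \<in> K \<Longrightarrow> x * y \<in> K"
  shows "mpoly_eval (\<lambda>c. c) x (norm_form K \<omega>s) =
    field_norm K (\<Sum>l<length \<omega>s. to_ac (x $ l) * \<omega>s ! l)"
proof -
  interpret comm_ring_hom "mpoly_eval (\<lambda>c::'a. c) x"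
    by (rule comm_ring_hom_mpoly_eval) (unfold_locales, simp_all)
  define cs where "cs = some_basis K"
  have cs: "is_basis K cs"
    unfolding cs_def some_basis_def using K(1) by (rule someI)
  have "map_mat (mpoly_eval (\<lambda>c. c) x) (generic_mult_matrix cs \<omega>s) =
      mult_matrix cs (\<Sum>l<length \<omega>s. to_ac (x $ l) * \<omega>s ! l)"
  proof (rule eq_matI)
    fix i j
    let ?\<beta> = "\<Sum>l<length \<omega>s. to_ac (x $ l) * \<omega>s ! l"
    assume "i < dim_row (mult_matrix cs ?\<beta>)" "j < dim_col (mult_matrix cs ?\<beta>)"
    then have ij: "i < length cs" "j < length cs" by (simp_all add: mult_matrix_def)
    have *: "\<omega>s ! l * cs ! j \<in> K" if "l < length \<omega>s" for l
      using that K is_basis_subset[OF cs] ij by (meson nth_mem subsetD)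
    have "?\<beta> * cs ! j = (\<Sum>l<length \<omega>s. to_ac (x $ l) * (\<omega>s ! l * cs ! j))"
      by (simp add: sum_distrib_right mult.assoc)
    then show "map_mat (mpoly_eval (\<lambda>c. c) x) (generic_mult_matrix cs \<omega>s) $$ (i, j) =
        mult_matrix cs ?\<beta> $$ (i, j)"
      using ij representation_linear[OF cs, of "{..<length \<omega>s}" "\<lambda>l. \<omega>s ! l * cs ! j"] *
      by (simp add: generic_mult_matrix_def mult_matrix_def hom_sum hom_mult mpoly_eval_mvar
          mpoly_eval_mconst)
  qed (simp_all add: generic_mult_matrix_def mult_matrix_def)
  then show ?thesis
    by (metis cs_def field_norm_def hom_det norm_form_def)
qed

lemma irreducible_bezout:
  fixes h g :: "'a::field poly"
  assumes h: "irreducible h" and g: "g \<noteq> 0" "degree g < degree h"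
  shows "\<exists>r s. r * h + s * g = 1"
proof -
  define I where "I = {r * h + s * g | r s. True}"
  have "g \<in> I"
    unfolding I_def by (rule CollectI, rule exI[of _ 0], rule exI[of _ 1]) simp
  with g have "\<exists>d. d \<in> I \<and> d \<noteq> 0" by blast
  then obtain d where d: "d \<in> I" "d \<noteq> 0" and min: "\<And>e. e \<in> I \<Longrightarrow> e \<noteq> 0 \<Longrightarrow> degree d \<le> degree e"
    using ex_has_least_nat[of "\<lambda>d. d \<in> I \<and> d \<noteq> 0" _ degree] by blast
  obtain r s where rs: "d = r * h + s * g"
    using d unfolding I_def by blast
  have dvd: "d dvd r' * h + s' * g" for r' s'
  proof (rule ccontr)
    define e where "e = r' * h + s' * g"
    assume "\<not> d dvd r' * h + s' * g"
    then have ne: "e mod d \<noteq> 0" by (simp add: e_def dvd_eq_mod_eq_0)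
    have "e mod d = e - e div d * d" by (simp add: minus_div_mult_eq_mod)
    also have "\<dots> = (r' - e div d * r) * h + (s' - e div d * s) * g"
      unfolding rs e_def by (simp add: algebra_simps)
    finally have "e mod d \<in> I" unfolding I_def by blast
    with min ne have "degree d \<le> degree (e mod d)" by blast
    moreover have "degree (e mod d) < degree d"
      using degree_mod_less[OF d(2), of e] ne by simp
    ultimately show False by simp
  qed
  have "d dvd h" "d dvd g"
    using dvd[of 1 0] dvd[of 0 1] by simp_all
  have "\<not> h dvd d"
    using \<open>d dvd g\<close> g dvd_imp_degree_le[of h g] dvd_trans[of h d g] by auto
  with \<open>d dvd h\<close> h have "is_unit d"
    using irreducibleD'[OF h, of d] by blast
  then obtain u where "1 = d * u" by (rule dvdE)
  then have "(u * r) * h + (u * s) * g = 1"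
    by (simp add: rs algebra_simps)
  then show ?thesis by blast
qed

context
  fixes a b :: "'a::field" and \<alpha> :: "'a alg_closure"
  assumes irr: "irreducible [:b, a, 0, 1:]"
    and root: "\<alpha> ^ 3 + to_ac a * \<alpha> + to_ac b = 0"
begin

definition power_comb :: "'a \<Rightarrow> 'a \<Rightarrow> 'a \<Rightarrow> 'a alg_closure"
  where "power_comb u v w = to_ac u + to_ac v * \<alpha> + to_ac w * \<alpha>\<^sup>2"

lemma root_cube: "\<alpha> ^ 3 = - to_ac a * \<alpha> - to_ac b"
  using root by (simp add: eq_neg_iff_add_eq_0 algebra_simps)

lemma map_to_ac_mult: "poly (map_poly to_ac (p * q)) \<alpha> = poly (map_poly to_ac p) \<alpha> * poly (map_poly to_ac q) \<alpha>"
  and map_to_ac_add: "poly (map_poly to_ac (p + q)) \<alpha> = poly (map_poly to_ac p) \<alpha> + poly (map_poly to_ac q) \<alpha>"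
proof -
  have add: "map_poly to_ac (p + q) = map_poly to_ac p + map_poly to_ac q" for p q :: "'a poly"
    by (rule poly_eqI) (simp add: coeff_map_poly)
  have smult: "map_poly to_ac (smult c q) = smult (to_ac c) (map_poly to_ac q)" for c and q :: "'a poly"
    by (rule poly_eqI) (simp add: coeff_map_poly)
  have pCons: "map_poly to_ac (pCons c q) = pCons (to_ac c) (map_poly to_ac q)" for c and q :: "'a poly"
    by (rule map_poly_pCons) simp
  show "poly (map_poly to_ac (p + q)) \<alpha> = poly (map_poly to_ac p) \<alpha> + poly (map_poly to_ac q) \<alpha>"
    by (simp add: add)
  show "poly (map_poly to_ac (p * q)) \<alpha> = poly (map_poly to_ac p) \<alpha> * poly (map_poly to_ac q) \<alpha>"
    by (induction p) (simp_all add: add smult pCons algebra_simps)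
qed

lemma poly_map_power_comb: "\<exists>u v w. poly (map_poly to_ac s) \<alpha> = power_comb u v w"
proof (induction s)
  case 0
  have "poly (map_poly to_ac 0) \<alpha> = power_comb 0 0 0" by (simp add: power_comb_def)
  then show ?case by blast
next
  case (pCons c s)
  then obtain u v w where *: "poly (map_poly to_ac s) \<alpha> = power_comb u v w" by blast
  have "poly (map_poly to_ac (pCons c s)) \<alpha> = to_ac c + \<alpha> * power_comb u v w"
    using pCons.hyps by (simp add: map_poly_pCons *)
  also have "\<dots> = to_ac c + to_ac u * \<alpha> + to_ac v * \<alpha>\<^sup>2 + to_ac w * \<alpha> ^ 3"
    by (simp add: power_comb_def algebra_simps power2_eq_square power3_eq_cube)
  also have "\<dots> = power_comb (c - b * w) (u - a * w) v"
    by (simp add: root_cube power_comb_def algebra_simps)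
  finally show ?case by blast
qed

lemma power_comb_inverse:
  assumes "u \<noteq> 0 \<or> v \<noteq> 0 \<or> w \<noteq> 0"
  shows "\<exists>u' v' w'. power_comb u v w * power_comb u' v' w' = 1"
proof -
  let ?h = "[:b, a, 0, 1:]" and ?g = "[:u, v, w:]"
  have "degree ?g < degree ?h" by (simp add: degree_pCons_eq_if)
  with irreducible_bezout[OF irr, of ?g] assms obtain r s where "r * ?h + s * ?g = 1" by auto
  then have "poly (map_poly to_ac (r * ?h + s * ?g)) \<alpha> = 1"
    by (simp only:) simp
  moreover have "poly (map_poly to_ac ?h) \<alpha> = 0"
    using root by (simp add: map_poly_pCons power3_eq_cube algebra_simps)
  moreover have "poly (map_poly to_ac ?g) \<alpha> = power_comb u v w"
    by (simp add: map_poly_pCons power_comb_def power2_eq_square algebra_simps)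
  ultimately have "poly (map_poly to_ac s) \<alpha> * power_comb u v w = 1"
    by (simp only: map_to_ac_add map_to_ac_mult mult_zero_right add_0)
  then show ?thesis using poly_map_power_comb[of s] by (metis mult.commute)
qed

lemma power_comb_eq_0: "power_comb u v w = 0 \<longleftrightarrow> u = 0 \<and> v = 0 \<and> w = 0"
proof
  assume "power_comb u v w = 0"
  with power_comb_inverse[of u v w] show "u = 0 \<and> v = 0 \<and> w = 0"
    by (metis mult_zero_left zero_neq_one)
qed (simp add: power_comb_def)

lemma power_comb_eq_iff: "power_comb u v w = power_comb u' v' w' \<longleftrightarrow> u = u' \<and> v = v' \<and> w = w'"
  using power_comb_eq_0[of "u - u'" "v - v'" "w - w'"] by (simp add: power_comb_def algebra_simps)

lemma powers_distinct: "distinct [1, \<alpha>, \<alpha>\<^sup>2]"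
proof -
  have "1 = power_comb 1 0 0" "\<alpha> = power_comb 0 1 0" "\<alpha>\<^sup>2 = power_comb 0 0 1" by (simp_all add: power_comb_def)
  then show ?thesis by (metis power_comb_eq_iff distinct_length_2_or_more distinct_singleton zero_neq_one)
qed

lemma span_powers: "ac_vs.span (set [1, \<alpha>, \<alpha>\<^sup>2]) = {power_comb u v w | u v w. True}"
proof -
  have "x \<in> ac_vs.span (set [1, \<alpha>, \<alpha>\<^sup>2]) \<longleftrightarrow> (\<exists>u v w. x = power_comb u v w)" for x
    by (simp add: ac_vs.span_insert ac_vs.span_empty power_comb_def) (simp add: algebra_simps)
  then show ?thesis by auto
qed

lemma independent_powers: "ac_vs.independent (set [1, \<alpha>, \<alpha>\<^sup>2])"
proof (rule ac_vs.independent_if_scalars_zero)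
  fix f x
  assume "(\<Sum>x\<in>set [1, \<alpha>, \<alpha>\<^sup>2]. to_ac (f x) * x) = 0" "x \<in> set [1, \<alpha>, \<alpha>\<^sup>2]"
  moreover have "(\<Sum>x\<in>set [1, \<alpha>, \<alpha>\<^sup>2]. to_ac (f x) * x) = power_comb (f 1) (f \<alpha>) (f (\<alpha>\<^sup>2))"
    using powers_distinct by (simp add: power_comb_def algebra_simps)
  ultimately show "f x = 0" by (auto simp: power_comb_eq_0)
qed simp

lemma adjoin_eq_power_comb: "adjoin \<alpha> = {power_comb u v w | u v w. True}"
proof (rule equalityI; rule subsetI)
  fix x assume "x \<in> {power_comb u v w | u v w. True}"
  moreover have "to_ac u + to_ac v * \<alpha> + to_ac w * \<alpha>\<^sup>2 \<in> adjoin \<alpha>" for u v w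
    unfolding power2_eq_square by (intro adjoin_add adjoin_mult adjoin_incl)
  ultimately show "x \<in> adjoin \<alpha>" by (auto simp: power_comb_def)
next
  let ?R = "ring_of_type_algebra :: 'a alg_closure ring"
  interpret R: Ring.field ?R by (rule field_from_type_algebra)
  let ?S = "{power_comb u v w | u v w. True}"
  have S: "x \<in> ?S \<longleftrightarrow> (\<exists>p. x = poly (map_poly to_ac p) \<alpha>)" for x
  proof
    assume "x \<in> ?S"
    then obtain u v w where "x = power_comb u v w" by blast
    then have "x = poly (map_poly to_ac [:u, v, w:]) \<alpha>"
      by (simp add: map_poly_pCons power_comb_def power2_eq_square algebra_simps)
    then show "\<exists>p. x = poly (map_poly to_ac p) \<alpha>" by blast
  qed (use poly_map_power_comb in blast)
  fix x assume "x \<in> adjoin \<alpha>"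
  then show "x \<in> ?S" unfolding adjoin_def
  proof (induction rule: generate_field.induct)
    case one
    have "1 = power_comb 1 0 0" by (simp add: power_comb_def)
    then show ?case by (auto simp: ring_of_type_algebra_def)
  next
    case (incl h)
    have "\<alpha> = power_comb 0 1 0" "to_ac c = power_comb c 0 0" for c by (simp_all add: power_comb_def)
    with incl show ?case by blast
  next
    case (a_inv h)
    then obtain u v w where h: "h = power_comb u v w" by blast
    have "h \<oplus>\<^bsub>?R\<^esub> (- h) = \<zero>\<^bsub>?R\<^esub>" by (simp add: ring_of_type_algebra_def)
    then have "\<ominus>\<^bsub>?R\<^esub> h = - h"
      by (intro R.minus_equality) (simp_all add: ring_of_type_algebra_def)
    also have "\<dots> = power_comb (- u) (- v) (- w)" by (simp add: h power_comb_def)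
    finally show ?case by blast
  next
    case (m_inv h)
    then obtain u v w where h: "h = power_comb u v w" by blast
    with m_inv(2) have "power_comb u v w \<noteq> 0" by (simp add: ring_of_type_algebra_def)
    with power_comb_inverse[of u v w] power_comb_eq_0[of u v w]
    obtain u' v' w' where *: "power_comb u v w * power_comb u' v' w' = 1" by blast
    have "inv\<^bsub>?R\<^esub> h = power_comb u' v' w'"
      using * by (intro R.comm_inv_char) (simp_all add: ring_of_type_algebra_def h)
    then show ?case by blast
  next
    case (eng_add h1 h2)
    then obtain u v w u' v' w' where h: "h1 = power_comb u v w" "h2 = power_comb u' v' w'" by blast
    have "h1 \<oplus>\<^bsub>?R\<^esub> h2 = power_comb (u + u') (v + v') (w + w')"
      by (simp add: h ring_of_type_algebra_def power_comb_def algebra_simps)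
    then show ?case by blast
  next
    case (eng_mult h1 h2)
    then obtain p q where "h1 = poly (map_poly to_ac p) \<alpha>" "h2 = poly (map_poly to_ac q) \<alpha>"
      unfolding S by blast
    then have "h1 \<otimes>\<^bsub>?R\<^esub> h2 = poly (map_poly to_ac (p * q)) \<alpha>"
      by (simp add: map_to_ac_mult ring_of_type_algebra_def)
    then show ?case unfolding S by blast
  qed
qed

lemma is_basis_powers: "is_basis (adjoin \<alpha>) [1, \<alpha>, \<alpha>\<^sup>2]"
  unfolding is_basis_def adjoin_eq_power_comb
  using powers_distinct independent_powers span_powers by blast

lemma representation_powers:
  "ac_vs.representation (set [1, \<alpha>, \<alpha>\<^sup>2]) (power_comb u v w) 1 = u"
  "ac_vs.representation (set [1, \<alpha>, \<alpha>\<^sup>2]) (power_comb u v w) \<alpha> = v"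
  "ac_vs.representation (set [1, \<alpha>, \<alpha>\<^sup>2]) (power_comb u v w) (\<alpha>\<^sup>2) = w"
proof -
  let ?r = "ac_vs.representation (set [1, \<alpha>, \<alpha>\<^sup>2]) (power_comb u v w)"
  have "(\<Sum>x\<in>set [1, \<alpha>, \<alpha>\<^sup>2]. to_ac (?r x) * x) = power_comb u v w"
    using span_powers independent_powers by (intro ac_vs.sum_representation_eq) auto
  moreover have "(\<Sum>x\<in>set [1, \<alpha>, \<alpha>\<^sup>2]. to_ac (?r x) * x) = power_comb (?r 1) (?r \<alpha>) (?r (\<alpha>\<^sup>2))"
    using powers_distinct by (simp add: power_comb_def algebra_simps del: list.set)
      (simp add: algebra_simps)
  ultimately show "?r 1 = u" "?r \<alpha> = v" "?r (\<alpha>\<^sup>2) = w" by (simp_all add: power_comb_eq_iff)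
qed

lemma det_3:
  fixes A :: "'c::comm_ring_1 mat"
  assumes A: "A \<in> carrier_mat 3 3"
  shows "det A = A $$ (0,0) * (A $$ (1,1) * A $$ (2,2) - A $$ (1,2) * A $$ (2,1))
    - A $$ (0,1) * (A $$ (1,0) * A $$ (2,2) - A $$ (1,2) * A $$ (2,0))
    + A $$ (0,2) * (A $$ (1,0) * A $$ (2,1) - A $$ (1,1) * A $$ (2,0))"
proof -
  have 2: "det B = B $$ (0,0) * B $$ (1,1) - B $$ (0,1) * B $$ (1,0)" if B: "B \<in> carrier_mat 2 2"
    for B :: "'c mat"
  proof -
    have 1: "det C = C $$ (0,0)" if "C \<in> carrier_mat 1 1" for C :: "'c mat"
      using that by (simp add: det_def)
    show ?thesis using B
      by (subst laplace_expansion_row[OF B, of 0])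
        (simp_all add: numeral_2_eq_2 cofactor_def 1 mat_delete_def)
  qed
  have dim: "dim_row A = 3" "dim_col A = 3"
    using A by auto
  have "mat_delete A 0 j \<in> carrier_mat 2 2" for j
    unfolding mat_delete_def by (simp add: dim)
  from 2[OF this] have minor: "det (mat_delete A 0 j) =
      mat_delete A 0 j $$ (0,0) * mat_delete A 0 j $$ (1,1)
      - mat_delete A 0 j $$ (0,1) * mat_delete A 0 j $$ (1,0)" for j .
  have "{..<3::nat} = {0, 1, 2}" by auto
  then have "det A = A $$ (0,0) * cofactor A 0 0 + A $$ (0,1) * cofactor A 0 1 + A $$ (0,2) * cofactor A 0 2"
    by (subst laplace_expansion_row[OF A, of 0]) (simp_all add: add.assoc)
  then show ?thesis
    by (simp add: cofactor_def minor) (simp add: mat_delete_def dim numeral_2_eq_2 algebra_simps)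
qed

lemma norm_form_cubic:
  "norm_form (adjoin \<alpha>) [1, \<alpha>, \<alpha>\<^sup>2] =
    (let A = mconst a; B = mconst b; X1 = mvar 0; X2 = mvar 1; X3 = mvar 2
     in X1 ^ 3 - B * X2 ^ 3 + B\<^sup>2 * X3 ^ 3 + (A * X2 + 3 * B * X3) * X1 * X2
        - (2 * A * X1\<^sup>2 - A\<^sup>2 * X1 * X3 + A * B * X2 * X3) * X3)"
proof -
  let ?bs = "[1, \<alpha>, \<alpha>\<^sup>2]"
  have eq: "norm_form (adjoin \<alpha>) ?bs = det (generic_mult_matrix ?bs ?bs)"
  proof (rule norm_form_eq_basis[OF is_basis_powers is_basis_subset[OF is_basis_powers]])
  qed (rule adjoin_mult)
  have prods: "1 = power_comb 1 0 0" "\<alpha> = power_comb 0 1 0" "\<alpha>\<^sup>2 = power_comb 0 0 1"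
    "\<alpha> * \<alpha> = power_comb 0 0 1" "\<alpha> * \<alpha>\<^sup>2 = power_comb (- b) (- a) 0" "\<alpha>\<^sup>2 * \<alpha> = power_comb (- b) (- a) 0"
  proof -
    show *: "\<alpha> * \<alpha>\<^sup>2 = power_comb (- b) (- a) 0"
      using root_cube by (simp add: power_comb_def power2_eq_square power3_eq_cube mult.assoc)
    then show "\<alpha>\<^sup>2 * \<alpha> = power_comb (- b) (- a) 0" by (simp add: mult.commute)
  qed (simp_all add: power_comb_def power2_eq_square)
  have prods4: "\<alpha> ^ 4 = power_comb 0 (- b) (- a)"
  proof -
    have "\<alpha> ^ 4 = \<alpha> * \<alpha> ^ 3" by (simp add: eval_nat_numeral)
    also have "\<dots> = power_comb 0 (- b) (- a)"
      unfolding root_cube by (simp add: power_comb_def power2_eq_square algebra_simps)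
    finally show ?thesis .
  qed
  note rep = representation_powers[of 1 0 0, folded prods(1)] representation_powers[of 0 1 0, folded prods(2)]
    representation_powers[of 0 0 1, folded prods(3)] representation_powers[of 0 0 1, folded prods(4)]
    representation_powers[of "- b" "- a" 0, folded prods(5)] representation_powers[of "- b" "- a" 0, folded prods(6)]
    representation_powers[of 0 "- b" "- a", folded prods4]
  let ?G = "generic_mult_matrix ?bs ?bs"
  have G: "?G \<in> carrier_mat 3 3" by (simp add: generic_mult_matrix_def numeral_3_eq_3)
  have mneg: "mconst (- c) = - mconst c" for c :: 'a by (simp add: mconst_def single_uminus)
  define S where "S = set ?bs"
  have entry: "?G $$ (i, j) = mvar 0 * mconst (ac_vs.representation S (?bs ! j) (?bs ! i))
      + mvar 1 * mconst (ac_vs.representation S (\<alpha> * ?bs ! j) (?bs ! i))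
      + mvar 2 * mconst (ac_vs.representation S (\<alpha>\<^sup>2 * ?bs ! j) (?bs ! i))"
    if "i < 3" "j < 3" for i j
    using that unfolding S_def
    by (simp add: generic_mult_matrix_def mult_matrix_def numeral_3_eq_3 numeral_2_eq_2 del: list.set)
  have entries: "?G $$ (0,0) = mvar 0" "?G $$ (1,0) = mvar 1" "?G $$ (2,0) = mvar 2"
    "?G $$ (0,1) = - mconst b * mvar 2" "?G $$ (1,1) = mvar 0 - mconst a * mvar 2" "?G $$ (2,1) = mvar 1"
    "?G $$ (0,2) = - mconst b * mvar 1" "?G $$ (1,2) = - mconst a * mvar 1 - mconst b * mvar 2"
    "?G $$ (2,2) = mvar 0 - mconst a * mvar 2"
    by (simp_all add: entry rep[folded S_def] mconst_simps mneg)
  show ?thesis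
    unfolding eq det_3[OF G] entries Let_def
    by (simp add: power2_eq_square power3_eq_cube algebra_simps)
qed

end

end

theory Submission
  imports Defs
begin

text \<open>
  If \<open>\<gamma> \<in> K\<close> has trace \<open>a\<^sub>4\<close> and \<open>1 / \<gamma>\<close> has trace zero, then \<open>N(t\<^sup>2 + \<gamma>) = t\<^sup>6 + a\<^sub>4 t\<^sup>4 + N(\<gamma>)\<close>, so
  that \<open>t = (N(\<gamma>) - a\<^sub>0) / a\<^sub>1\<close> gives a point of the hypersurface. The elements \<open>\<delta>\<close> of trace zero form a
  plane, hence \<open>\<gamma> = c / \<delta>\<close> runs through a rational curve, and \<open>t\<close> is not constant on it because the
  discriminant of \<open>h\<close> does not vanish. Multiplying the points of the curve by the elements
  \<open>z\<^sup>3 / N(z)\<close> of norm 1 covers the fibres over infinitely many values of \<open>t\<close>. These fibres are dense: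
  over the algebraic closure the hypersurface is \<open>y\<^sub>1 y\<^sub>2 y\<^sub>3 = f(t)\<close>, and through each of its points
  there is an arc along which \<open>t = t\<^sub>0 + s\<^sup>3\<close>.
\<close>

section \<open>Cubic algebras\<close>

text \<open>Triples are coordinates with respect to 1, \<alpha>, \<alpha>^2 in the algebra with
  \<alpha>^3 = - a \<alpha> - b. Allowing any commutative ring lets one formula serve for
  polynomials over k and for points over its closure.\<close>

fun cmul :: "'a::comm_ring_1 \<Rightarrow> 'a \<Rightarrow> 'a \<times> 'a \<times> 'a \<Rightarrow> 'a \<times> 'a \<times> 'a \<Rightarrow> 'a \<times> 'a \<times> 'a"
  where "cmul a b (x\<^sub>0, x\<^sub>1, x\<^sub>2) (y\<^sub>0, y\<^sub>1, y\<^sub>2) =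
    (x\<^sub>0 * y\<^sub>0 - b * (x\<^sub>1 * y\<^sub>2 + x\<^sub>2 * y\<^sub>1),
     x\<^sub>0 * y\<^sub>1 + x\<^sub>1 * y\<^sub>0 - a * (x\<^sub>1 * y\<^sub>2 + x\<^sub>2 * y\<^sub>1) - b * (x\<^sub>2 * y\<^sub>2),
     x\<^sub>0 * y\<^sub>2 + x\<^sub>1 * y\<^sub>1 + x\<^sub>2 * y\<^sub>0 - a * (x\<^sub>2 * y\<^sub>2))"

text \<open>The cubic form that \<open>norm_form_cubic\<close> computes for the norm of K/k.\<close>

fun cnorm :: "'a::comm_ring_1 \<Rightarrow> 'a \<Rightarrow> 'a \<times> 'a \<times> 'a \<Rightarrow> 'a"
  where "cnorm a b (x\<^sub>0, x\<^sub>1, x\<^sub>2) =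
    x\<^sub>0 ^ 3 - b * x\<^sub>1 ^ 3 + b\<^sup>2 * x\<^sub>2 ^ 3 + (a * x\<^sub>1 + 3 * b * x\<^sub>2) * x\<^sub>0 * x\<^sub>1
      - (2 * a * x\<^sub>0\<^sup>2 - a\<^sup>2 * x\<^sub>0 * x\<^sub>2 + a * b * x\<^sub>1 * x\<^sub>2) * x\<^sub>2"

text \<open>For a root \<open>r\<close> of the cubic this is multiplicative and gives one of the
  conjugates of the element.\<close>

fun ceval :: "'a::comm_ring_1 \<Rightarrow> 'a \<times> 'a \<times> 'a \<Rightarrow> 'a"
  where "ceval r (x\<^sub>0, x\<^sub>1, x\<^sub>2) = x\<^sub>0 + r * x\<^sub>1 + r\<^sup>2 * x\<^sub>2"

fun caffine :: "'a::comm_ring_1 \<Rightarrow> 'a \<Rightarrow> 'a \<times> 'a \<times> 'a \<Rightarrow> 'a \<times> 'a \<times> 'a"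
  where "caffine s c (x\<^sub>0, x\<^sub>1, x\<^sub>2) = (s + c * x\<^sub>0, c * x\<^sub>1, c * x\<^sub>2)"

fun cmap :: "('a \<Rightarrow> 'b) \<Rightarrow> 'a \<times> 'a \<times> 'a \<Rightarrow> 'b \<times> 'b \<times> 'b"
  where "cmap \<phi> (x\<^sub>0, x\<^sub>1, x\<^sub>2) = (\<phi> x\<^sub>0, \<phi> x\<^sub>1, \<phi> x\<^sub>2)"

definition ccube :: "'a::comm_ring_1 \<Rightarrow> 'a \<Rightarrow> 'a \<times> 'a \<times> 'a \<Rightarrow> 'a \<times> 'a \<times> 'a"
  where "ccube a b x = cmul a b x (cmul a b x x)"

text \<open>
  For \<open>\<delta> = 2 a + u \<alpha> + 3 \<alpha>\<^sup>2\<close>, an element of trace zero, \<open>adj_point\<close> is the adjoint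
  \<open>N(\<delta>) / \<delta>\<close>, \<open>adj_trace\<close> is its trace and \<open>adj_norm\<close> is \<open>N(\<delta>)\<close>.
\<close>

definition adj_point :: "'a::comm_ring_1 \<Rightarrow> 'a \<Rightarrow> 'a \<Rightarrow> 'a \<times> 'a \<times> 'a"
  where "adj_point a b u = (a * u\<^sup>2 + 3 * b * u + a\<^sup>2, - 2 * a * u - 9 * b, u\<^sup>2 + 3 * a)"

definition adj_trace :: "'a::comm_ring_1 \<Rightarrow> 'a \<Rightarrow> 'a \<Rightarrow> 'a"
  where "adj_trace a b u = a * u\<^sup>2 + 9 * b * u - 3 * a\<^sup>2"

definition adj_norm :: "'a::comm_ring_1 \<Rightarrow> 'a \<Rightarrow> 'a \<Rightarrow> 'a"
  where "adj_norm a b u = - b * u ^ 3 + 2 * a\<^sup>2 * u\<^sup>2 + 9 * a * b * u + 2 * a ^ 3 + 27 * b\<^sup>2"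

text \<open>
  The conjugates of \<open>N(\<delta>) / \<delta>\<close> have vanishing second elementary symmetric function because \<open>\<delta>\<close>
  has trace zero. Hence there is no term linear in \<open>s\<close>.
\<close>

lemma cnorm_adj_point:
  fixes a b :: "'a::field"
  shows "cnorm a b (caffine s c (adj_point a b u)) =
    s ^ 3 + s\<^sup>2 * c * adj_trace a b u + c ^ 3 * (adj_norm a b u)\<^sup>2"
  unfolding adj_point_def adj_trace_def adj_norm_def caffine.simps cnorm.simps
  by Groebner_Basis.algebra

section \<open>Compatibility of the formulas with ring homomorphisms\<close>

context comm_ring_hom
begin

text \<open>Evaluation at a point is a homomorphism, so this and the following rules carry the
  parametrisation from polynomials over k to points over the closure.\<close>

lemma hom_cmul: "cmap hom (cmul a b x y) = cmul (hom a) (hom b) (cmap hom x) (cmap hom y)"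
  by (cases x; cases y) (simp add: hom_distribs)

lemma hom_ccube: "cmap hom (ccube a b x) = ccube (hom a) (hom b) (cmap hom x)"
  by (simp add: ccube_def hom_cmul)

lemma hom_cnorm: "hom (cnorm a b x) = cnorm (hom a) (hom b) (cmap hom x)"
  by (cases x) (simp add: hom_distribs)

lemma hom_caffine: "cmap hom (caffine s c x) = caffine (hom s) (hom c) (cmap hom x)"
  by (cases x) (simp add: hom_distribs)

lemma hom_adj_point: "cmap hom (adj_point a b u) = adj_point (hom a) (hom b) (hom u)"
  by (simp add: adj_point_def hom_distribs)

lemma hom_adj_trace: "hom (adj_trace a b u) = adj_trace (hom a) (hom b) (hom u)"
  by (simp add: adj_trace_def hom_distribs)

lemma hom_adj_norm: "hom (adj_norm a b u) = adj_norm (hom a) (hom b) (hom u)"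
  by (simp add: adj_norm_def hom_distribs)

end

text \<open>Substituting \<open>- (r ^ 3) - a * r\<close> for \<open>b\<close> turns the claim into
  a polynomial identity.\<close>

lemma ceval_cmul:
  fixes a b r :: "'a::field"
  assumes "r ^ 3 + a * r + b = 0"
  shows "ceval r (cmul a b x y) = ceval r x * ceval r y"
proof -
  have b: "b = - (r ^ 3) - a * r" using assms by Groebner_Basis.algebra
  obtain x\<^sub>0 x\<^sub>1 x\<^sub>2 y\<^sub>0 y\<^sub>1 y\<^sub>2 where xy: "x = (x\<^sub>0, x\<^sub>1, x\<^sub>2)" "y = (y\<^sub>0, y\<^sub>1, y\<^sub>2)"
    by (cases x; cases y)
  show ?thesis unfolding xy cmul.simps ceval.simps b by Groebner_Basis.algebra
qed

lemma ceval_ccube: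
  fixes a b r :: "'a::field"
  assumes "r ^ 3 + a * r + b = 0"
  shows "ceval r (ccube a b x) = ceval r x ^ 3"
  by (simp add: ccube_def ceval_cmul[OF assms] power3_eq_cube mult.assoc)

section \<open>Cubics with three distinct roots in the field\<close>

locale split_cubic =
  fixes a b r\<^sub>1 r\<^sub>2 r\<^sub>3 :: "'c::field"
  assumes sum_roots: "r\<^sub>1 + r\<^sub>2 + r\<^sub>3 = 0"
    and a_eq: "a = r\<^sub>1 * r\<^sub>2 + r\<^sub>1 * r\<^sub>3 + r\<^sub>2 * r\<^sub>3"
    and b_eq: "b = - (r\<^sub>1 * r\<^sub>2 * r\<^sub>3)"
    and distinct_roots: "r\<^sub>1 \<noteq> r\<^sub>2" "r\<^sub>1 \<noteq> r\<^sub>3" "r\<^sub>2 \<noteq> r\<^sub>3"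
begin

lemma r3_eq: "r\<^sub>3 = - r\<^sub>1 - r\<^sub>2"
  using sum_roots by Groebner_Basis.algebra

lemma roots: "r\<^sub>1 ^ 3 + a * r\<^sub>1 + b = 0" "r\<^sub>2 ^ 3 + a * r\<^sub>2 + b = 0" "r\<^sub>3 ^ 3 + a * r\<^sub>3 + b = 0"
  unfolding a_eq b_eq r3_eq by Groebner_Basis.algebra+

text \<open>Once \<open>a\<close>, \<open>b\<close> and \<open>r\<^sub>3\<close> are expressed
  through \<open>r\<^sub>1\<close> and \<open>r\<^sub>2\<close>, both sides are the same polynomial.
  This turns the norm equation into \<open>y\<^sub>1 y\<^sub>2 y\<^sub>3 = f(t)\<close>.\<close>

lemma cnorm_eq_prod: "cnorm a b x = ceval r\<^sub>1 x * ceval r\<^sub>2 x * ceval r\<^sub>3 x"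
proof -
  obtain x\<^sub>0 x\<^sub>1 x\<^sub>2 where x: "x = (x\<^sub>0, x\<^sub>1, x\<^sub>2)" by (cases x)
  show ?thesis
    unfolding x cnorm.simps ceval.simps a_eq b_eq r3_eq by Groebner_Basis.algebra
qed

text \<open>Lagrange interpolation: the coefficients of the polynomial of degree at most 2 with
  prescribed values at the three roots.\<close>

definition interp :: "'c \<times> 'c \<times> 'c \<Rightarrow> 'c \<times> 'c \<times> 'c"
  where "interp = (\<lambda>(w\<^sub>1, w\<^sub>2, w\<^sub>3).
    let c\<^sub>1 = w\<^sub>1 / ((r\<^sub>1 - r\<^sub>2) * (r\<^sub>1 - r\<^sub>3)); c\<^sub>2 = w\<^sub>2 / ((r\<^sub>2 - r\<^sub>1) * (r\<^sub>2 - r\<^sub>3));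
        c\<^sub>3 = w\<^sub>3 / ((r\<^sub>3 - r\<^sub>1) * (r\<^sub>3 - r\<^sub>2))
    in (c\<^sub>1 * (r\<^sub>2 * r\<^sub>3) + c\<^sub>2 * (r\<^sub>1 * r\<^sub>3) + c\<^sub>3 * (r\<^sub>1 * r\<^sub>2),
        - (c\<^sub>1 * (r\<^sub>2 + r\<^sub>3) + c\<^sub>2 * (r\<^sub>1 + r\<^sub>3) + c\<^sub>3 * (r\<^sub>1 + r\<^sub>2)),
        c\<^sub>1 + c\<^sub>2 + c\<^sub>3))"

lemma ceval_interp:
  "ceval r\<^sub>1 (interp (w\<^sub>1, w\<^sub>2, w\<^sub>3)) = w\<^sub>1"
  "ceval r\<^sub>2 (interp (w\<^sub>1, w\<^sub>2, w\<^sub>3)) = w\<^sub>2"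
  "ceval r\<^sub>3 (interp (w\<^sub>1, w\<^sub>2, w\<^sub>3)) = w\<^sub>3"
proof -
  define c\<^sub>1 c\<^sub>2 c\<^sub>3 where "c\<^sub>1 = w\<^sub>1 / ((r\<^sub>1 - r\<^sub>2) * (r\<^sub>1 - r\<^sub>3))"
    and "c\<^sub>2 = w\<^sub>2 / ((r\<^sub>2 - r\<^sub>1) * (r\<^sub>2 - r\<^sub>3))" and "c\<^sub>3 = w\<^sub>3 / ((r\<^sub>3 - r\<^sub>1) * (r\<^sub>3 - r\<^sub>2))"
  \<comment> \<open>Expressing the values through the Lagrange coefficients removes the divisions
    and leaves polynomial identities.\<close>
  have w: "w\<^sub>1 = c\<^sub>1 * ((r\<^sub>1 - r\<^sub>2) * (r\<^sub>1 - r\<^sub>3))" "w\<^sub>2 = c\<^sub>2 * ((r\<^sub>2 - r\<^sub>1) * (r\<^sub>2 - r\<^sub>3))"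
    "w\<^sub>3 = c\<^sub>3 * ((r\<^sub>3 - r\<^sub>1) * (r\<^sub>3 - r\<^sub>2))"
    using distinct_roots by (simp_all add: c\<^sub>1_def c\<^sub>2_def c\<^sub>3_def)
  have *: "interp (w\<^sub>1, w\<^sub>2, w\<^sub>3) =
      (c\<^sub>1 * (r\<^sub>2 * r\<^sub>3) + c\<^sub>2 * (r\<^sub>1 * r\<^sub>3) + c\<^sub>3 * (r\<^sub>1 * r\<^sub>2),
        - (c\<^sub>1 * (r\<^sub>2 + r\<^sub>3) + c\<^sub>2 * (r\<^sub>1 + r\<^sub>3) + c\<^sub>3 * (r\<^sub>1 + r\<^sub>2)),
        c\<^sub>1 + c\<^sub>2 + c\<^sub>3)"
    by (simp add: interp_def Let_def c\<^sub>1_def c\<^sub>2_def c\<^sub>3_def)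
  show "ceval r\<^sub>1 (interp (w\<^sub>1, w\<^sub>2, w\<^sub>3)) = w\<^sub>1" using w(1) unfolding * ceval.simps by Groebner_Basis.algebra
  show "ceval r\<^sub>2 (interp (w\<^sub>1, w\<^sub>2, w\<^sub>3)) = w\<^sub>2" using w(2) unfolding * ceval.simps by Groebner_Basis.algebra
  show "ceval r\<^sub>3 (interp (w\<^sub>1, w\<^sub>2, w\<^sub>3)) = w\<^sub>3" using w(3) unfolding * ceval.simps by Groebner_Basis.algebra
qed

text \<open>Three distinct nodes determine a polynomial of degree at most 2: first and second
  divided differences of \<open>x - y\<close> vanish, which kills its coefficients from the top
  down.\<close>

lemma ceval_inject:
  assumes "ceval r\<^sub>1 x = ceval r\<^sub>1 y" "ceval r\<^sub>2 x = ceval r\<^sub>2 y" "ceval r\<^sub>3 x = ceval r\<^sub>3 y"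
  shows "x = y"
proof -
  obtain x\<^sub>0 x\<^sub>1 x\<^sub>2 y\<^sub>0 y\<^sub>1 y\<^sub>2 where xy: "x = (x\<^sub>0, x\<^sub>1, x\<^sub>2)" "y = (y\<^sub>0, y\<^sub>1, y\<^sub>2)"
    by (cases x; cases y)
  define d\<^sub>0 d\<^sub>1 d\<^sub>2 where "d\<^sub>0 = x\<^sub>0 - y\<^sub>0" "d\<^sub>1 = x\<^sub>1 - y\<^sub>1" "d\<^sub>2 = x\<^sub>2 - y\<^sub>2"
  note d = this
  have e: "d\<^sub>0 + r\<^sub>1 * d\<^sub>1 + r\<^sub>1\<^sup>2 * d\<^sub>2 = 0" "d\<^sub>0 + r\<^sub>2 * d\<^sub>1 + r\<^sub>2\<^sup>2 * d\<^sub>2 = 0"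
    "d\<^sub>0 + r\<^sub>3 * d\<^sub>1 + r\<^sub>3\<^sup>2 * d\<^sub>2 = 0"
    using assms by (simp_all add: xy d algebra_simps)
  have "(r\<^sub>1 - r\<^sub>2) * (d\<^sub>1 + (r\<^sub>1 + r\<^sub>2) * d\<^sub>2) = 0" "(r\<^sub>1 - r\<^sub>3) * (d\<^sub>1 + (r\<^sub>1 + r\<^sub>3) * d\<^sub>2) = 0"
    using e by Groebner_Basis.algebra+
  then have f: "d\<^sub>1 + (r\<^sub>1 + r\<^sub>2) * d\<^sub>2 = 0" "d\<^sub>1 + (r\<^sub>1 + r\<^sub>3) * d\<^sub>2 = 0"
    using distinct_roots by simp_all
  then have "(r\<^sub>2 - r\<^sub>3) * d\<^sub>2 = 0" by Groebner_Basis.algebra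
  then have "d\<^sub>2 = 0" using distinct_roots by simp
  with f have "d\<^sub>1 = 0" by simp
  with \<open>d\<^sub>2 = 0\<close> e have "d\<^sub>0 = 0" by simp
  with \<open>d\<^sub>1 = 0\<close> \<open>d\<^sub>2 = 0\<close> show ?thesis by (simp add: xy d)
qed

end

text \<open>The quotient of the cubic by X - \<alpha> has a root \<open>r\<close>, and the third
  root is - \<alpha> - r. The three are distinct because the discriminant is, up to sign, the square
  of the product of their differences.\<close>

lemma split_cubic_exists:
  fixes a b \<alpha> :: "'c::alg_closed_field"
  assumes root: "\<alpha> ^ 3 + a * \<alpha> + b = 0" and disc: "4 * a ^ 3 + 27 * b\<^sup>2 \<noteq> 0"
  shows "\<exists>r\<^sub>2 r\<^sub>3. split_cubic a b \<alpha> r\<^sub>2 r\<^sub>3"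
proof -
  \<comment> \<open>This is the quotient of X^3 + a X + b by X - \<alpha>.\<close>
  have "degree [:a + \<alpha>\<^sup>2, \<alpha>, 1:] > 0" by simp
  then obtain r where "poly [:a + \<alpha>\<^sup>2, \<alpha>, 1:] r = 0"
    using alg_closed_imp_poly_has_root by blast
  then have a: "a = - \<alpha>\<^sup>2 - r * \<alpha> - r\<^sup>2" by (simp, Groebner_Basis.algebra)
  have b: "b = - (\<alpha> ^ 3) - a * \<alpha>" using root by Groebner_Basis.algebra
  let ?s = "- \<alpha> - r"
  have "4 * a ^ 3 + 27 * b\<^sup>2 = - (((\<alpha> - r) * (\<alpha> - ?s) * (r - ?s))\<^sup>2)"
    unfolding b unfolding a by Groebner_Basis.algebra
  with disc have "(\<alpha> - r) * (\<alpha> - ?s) * (r - ?s) \<noteq> 0" by (metis neg_0_equal_iff_equal zero_power2)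
  then have "\<alpha> \<noteq> r" "\<alpha> \<noteq> ?s" "r \<noteq> ?s" by auto
  moreover have "a = \<alpha> * r + \<alpha> * ?s + r * ?s" unfolding a by Groebner_Basis.algebra
  moreover have "b = - (\<alpha> * r * ?s)" unfolding b unfolding a by Groebner_Basis.algebra
  ultimately have "split_cubic a b \<alpha> r ?s" by (intro split_cubic.intro) simp_all
  then show ?thesis by blast
qed

section \<open>Density\<close>

text \<open>Along a polynomial arc \<open>V\<close>, \<open>p\<close> becomes a univariate
  polynomial in the parameter, to which root counting applies. The variables of \<open>p\<close> are
  bounded because \<open>map_vec\<close> determines only the entries below the dimension.\<close>

lemma mpoly_eval_poly_vec:
  fixes V :: "'c::comm_ring_1 poly vec"
  assumes "p \<in> mpolys n" "dim_vec V = n"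
  shows "mpoly_eval (\<lambda>c. c) (map_vec (\<lambda>q. poly q s) V) p = poly (mpoly_eval (\<lambda>c. [:c:]) V p) s"
proof -
  have "i < n" if "m \<in> Poly_Mapping.keys p" "i \<in> Poly_Mapping.keys m" for m i
    using assms(1) that by (auto simp: mpolys_def)
  then show ?thesis
    by (simp add: mpoly_eval_def poly_sum poly_prod assms(2))
qed

lemma vec_4_eqI:
  assumes "x \<in> carrier_vec 4" "y \<in> carrier_vec 4"
    and "x $ 0 = y $ 0" "x $ 1 = y $ 1" "x $ 2 = y $ 2" "x $ 3 = y $ 3"
  shows "x = y"
proof (rule eq_vecI)
  fix i assume "i < dim_vec y"
  with assms(2) consider "i = 0" | "i = 1" | "i = 2" | "i = 3" by fastforce
  then show "x $ i = y $ i" using assms by cases simp_all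
qed (use assms in simp)

lemma vec_of_list_4:
  "dim_vec (vec_of_list [p, q, r, s]) = 4" "vec_of_list [p, q, r, s] \<in> carrier_vec 4"
  "vec_of_list [p, q, r, s] $ 0 = p" "vec_of_list [p, q, r, s] $ 1 = q"
  "vec_of_list [p, q, r, s] $ 2 = r" "vec_of_list [p, q, r, s] $ 3 = s"
proof -
  show "dim_vec (vec_of_list [p, q, r, s]) = 4"
    by (simp only: dim_vec_of_list) simp
  then show "vec_of_list [p, q, r, s] \<in> carrier_vec 4" by (rule carrier_vecI)
qed (simp_all only: vec_of_list_index, simp_all add: numeral_2_eq_2 numeral_3_eq_3)

lemma poly_eq_0_if_infinite_zeros:
  fixes p :: "'c::idom poly"
  assumes "infinite S" "\<And>s. s \<in> S \<Longrightarrow> poly p s = 0"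
  shows "p = 0"
  using assms poly_roots_finite[of p] finite_subset[of S "{s. poly p s = 0}"] by blast

text \<open>
  A degenerate factorisation, with two or three vanishing factors, still deforms because \<open>q\<close> may be
  distributed as \<open>s * (s\<^sup>2 * g)\<close> or \<open>s * s * (s * g)\<close>.
\<close>

lemma deform_factorization:
  fixes q :: "'c::field poly"
  assumes q: "poly q 0 = w\<^sub>1 * w\<^sub>2 * w\<^sub>3" and dvd: "monom 1 3 dvd q - [:poly q 0:]"
  shows "\<exists>Y\<^sub>1 Y\<^sub>2 Y\<^sub>3. Y\<^sub>1 * Y\<^sub>2 * Y\<^sub>3 = q \<and> poly Y\<^sub>1 0 = w\<^sub>1 \<and> poly Y\<^sub>2 0 = w\<^sub>2 \<and> poly Y\<^sub>3 0 = w\<^sub>3"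
proof -
  let ?x = "[:0, 1:] :: 'c poly"
  have unit: "smult (1 / (v * w)) q * [:v:] * [:w:] = q" if "v \<noteq> 0" "w \<noteq> 0" for v w
    using that by simp
  \<comment> \<open>If two values are nonzero, they stay constant and the third factor carries all
    of \<open>q\<close>. Otherwise two values vanish, so \<open>q\<close> vanishes at 0 and is
    divisible by the cube of the variable.\<close>
  consider "w\<^sub>2 \<noteq> 0 \<and> w\<^sub>3 \<noteq> 0" | "w\<^sub>1 \<noteq> 0 \<and> w\<^sub>3 \<noteq> 0" | "w\<^sub>1 \<noteq> 0 \<and> w\<^sub>2 \<noteq> 0"
    | "w\<^sub>1 = 0 \<and> w\<^sub>2 = 0" | "w\<^sub>1 = 0 \<and> w\<^sub>3 = 0" | "w\<^sub>2 = 0 \<and> w\<^sub>3 = 0" by blast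
  then show ?thesis
  proof cases
    case 1
    then show ?thesis using unit[of w\<^sub>2 w\<^sub>3] q
      by (intro exI[of _ "smult (1 / (w\<^sub>2 * w\<^sub>3)) q"] exI[of _ "[:w\<^sub>2:]"] exI[of _ "[:w\<^sub>3:]"]) simp
  next
    case 2
    then show ?thesis using unit[of w\<^sub>1 w\<^sub>3] q
      by (intro exI[of _ "[:w\<^sub>1:]"] exI[of _ "smult (1 / (w\<^sub>1 * w\<^sub>3)) q"] exI[of _ "[:w\<^sub>3:]"]) simp
  next
    case 3
    then show ?thesis using unit[of w\<^sub>1 w\<^sub>2] q
      by (intro exI[of _ "[:w\<^sub>1:]"] exI[of _ "[:w\<^sub>2:]"] exI[of _ "smult (1 / (w\<^sub>1 * w\<^sub>2)) q"]) simp
  next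
    case 4
    with q have "poly q 0 = 0" by simp
    with dvd obtain g where g: "q = ?x * ?x * ?x * g"
      by (auto simp: dvd_def monom_altdef power3_eq_cube)
    define Y\<^sub>3 where "Y\<^sub>3 = (if w\<^sub>3 = 0 then ?x else [:w\<^sub>3:])"
    have "q = ?x * (smult (1 / w\<^sub>3) (?x * ?x * g)) * [:w\<^sub>3:]" if "w\<^sub>3 \<noteq> 0"
      unfolding g using that by simp
    then show ?thesis using 4 g
      by (intro exI[of _ ?x] exI[of _ "if w\<^sub>3 = 0 then ?x * g else smult (1 / w\<^sub>3) (?x * ?x * g)"] exI[of _ Y\<^sub>3])
        (auto simp: Y\<^sub>3_def)
  next
    case 5
    with q have "poly q 0 = 0" by simp
    with dvd obtain g where g: "q = ?x * ?x * ?x * g"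
      by (auto simp: dvd_def monom_altdef power3_eq_cube)
    define Y\<^sub>2 where "Y\<^sub>2 = (if w\<^sub>2 = 0 then ?x else [:w\<^sub>2:])"
    show ?thesis using 5 g
      by (intro exI[of _ ?x] exI[of _ Y\<^sub>2] exI[of _ "if w\<^sub>2 = 0 then ?x * g else smult (1 / w\<^sub>2) (?x * ?x * g)"])
        (auto simp: Y\<^sub>2_def)
  next
    case 6
    with q have "poly q 0 = 0" by simp
    with dvd obtain g where g: "q = ?x * ?x * ?x * g"
      by (auto simp: dvd_def monom_altdef power3_eq_cube)
    define Y\<^sub>1 where "Y\<^sub>1 = (if w\<^sub>1 = 0 then ?x else [:w\<^sub>1:])"
    show ?thesis using 6 g
      by (intro exI[of _ Y\<^sub>1] exI[of _ ?x] exI[of _ "if w\<^sub>1 = 0 then ?x * g else smult (1 / w\<^sub>1) (?x * ?x * g)"])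
        (auto simp: Y\<^sub>1_def)
  qed
qed

text \<open>\<open>f(t + s^3)\<close> is a polynomial in \<open>s^3\<close>, so its nonconstant part
  is divisible by \<open>s^3\<close>. The exponent 3 provides one factor \<open>s\<close> for each
  of the three conjugates.\<close>

lemma monom_dvd_pcompose_cubic:
  fixes f :: "'c::comm_ring_1 poly" and t :: 'c
  defines "q \<equiv> pcompose f [:t, 0, 0, 1:]"
  shows "monom 1 3 dvd q - [:poly q 0:]"
  unfolding q_def
proof (induction f)
  case (pCons c f)
  define r where "r = pcompose f [:t, 0, 0, 1:]"
  define m :: "'c poly" where "m = monom 1 3"
  have m: "[:t, 0, 0, 1:] = [:t:] + m" and m0: "poly m 0 = 0"
    by (simp_all add: m_def monom_altdef power3_eq_cube)
  have *: "pcompose (pCons c f) [:t, 0, 0, 1:] = [:c:] + ([:t:] + m) * r"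
    by (simp only: pcompose_pCons r_def m)
  have "pcompose (pCons c f) [:t, 0, 0, 1:] - [:poly (pcompose (pCons c f) [:t, 0, 0, 1:]) 0:] =
      [:t:] * (r - [:poly r 0:]) + m * r"
    unfolding * by (simp add: m0 algebra_simps)
  with pCons show ?case by (simp add: r_def[symmetric] m_def[symmetric] dvd_smult)
qed simp

text \<open>An arc on the hypersurface through \<open>x\<close> with last coordinate
  \<open>t + s^3\<close> lies over \<open>T\<close> for infinitely many \<open>s\<close>. Hence
  \<open>p\<close> vanishes along the whole arc, in particular at \<open>x\<close>. The assumption
  \<open>zero\<close> is confined to nonzero values of \<open>f\<close> since
  \<open>point_surj\<close> reaches only those fibres.\<close>

lemma (in split_cubic) mpoly_eval_zero_on_hypersurface:
  fixes f :: "'c poly" and x :: "'c vec"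
  assumes p: "p \<in> mpolys 4" and T: "infinite T" and f: "f \<noteq> 0"
    and cubes: "\<And>t. \<exists>s::'c. s ^ 3 = t"
    and zero: "\<And>x. x \<in> carrier_vec 4 \<Longrightarrow> x $ 3 \<in> T \<Longrightarrow> poly f (x $ 3) \<noteq> 0 \<Longrightarrow>
      cnorm a b (x $ 0, x $ 1, x $ 2) = poly f (x $ 3) \<Longrightarrow> mpoly_eval (\<lambda>c. c) x p = 0"
    and x: "x \<in> carrier_vec 4" "cnorm a b (x $ 0, x $ 1, x $ 2) = poly f (x $ 3)"
  shows "mpoly_eval (\<lambda>c. c) x p = 0"
proof -
  define t where "t = x $ 3"
  define q where "q = pcompose f [:t, 0, 0, 1:]"
  define x' where "x' = (x $ 0, x $ 1, x $ 2)"
  have q: "poly q s = poly f (t + s ^ 3)" for s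
    by (simp add: q_def poly_pcompose power3_eq_cube algebra_simps)
  have "poly q 0 = ceval r\<^sub>1 x' * ceval r\<^sub>2 x' * ceval r\<^sub>3 x'"
    using x(2) by (simp add: q x'_def t_def cnorm_eq_prod del: cnorm.simps ceval.simps)
  from deform_factorization[OF this] obtain Y\<^sub>1 Y\<^sub>2 Y\<^sub>3 where Y: "Y\<^sub>1 * Y\<^sub>2 * Y\<^sub>3 = q"
      "poly Y\<^sub>1 0 = ceval r\<^sub>1 x'" "poly Y\<^sub>2 0 = ceval r\<^sub>2 x'" "poly Y\<^sub>3 0 = ceval r\<^sub>3 x'"
    using monom_dvd_pcompose_cubic[of f t] by (auto simp: q_def)
  define Y where "Y s = (poly Y\<^sub>1 s, poly Y\<^sub>2 s, poly Y\<^sub>3 s)" for s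
  \<comment> \<open>Interpolation is linear in the values, so the coordinates of the arc are again
    polynomials in \<open>s\<close>.\<close>
  have "\<exists>X\<^sub>0 X\<^sub>1 X\<^sub>2. \<forall>s. interp (Y s) = (poly X\<^sub>0 s, poly X\<^sub>1 s, poly X\<^sub>2 s)"
  proof -
    define k\<^sub>1 k\<^sub>2 k\<^sub>3 where "k\<^sub>1 = inverse ((r\<^sub>1 - r\<^sub>2) * (r\<^sub>1 - r\<^sub>3))"
      and "k\<^sub>2 = inverse ((r\<^sub>2 - r\<^sub>1) * (r\<^sub>2 - r\<^sub>3))" and "k\<^sub>3 = inverse ((r\<^sub>3 - r\<^sub>1) * (r\<^sub>3 - r\<^sub>2))"
    note k = this
    have "interp (Y s) =
      (poly (smult (k\<^sub>1 * (r\<^sub>2 * r\<^sub>3)) Y\<^sub>1 + smult (k\<^sub>2 * (r\<^sub>1 * r\<^sub>3)) Y\<^sub>2 + smult (k\<^sub>3 * (r\<^sub>1 * r\<^sub>2)) Y\<^sub>3) s,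
       poly (- (smult (k\<^sub>1 * (r\<^sub>2 + r\<^sub>3)) Y\<^sub>1 + smult (k\<^sub>2 * (r\<^sub>1 + r\<^sub>3)) Y\<^sub>2 + smult (k\<^sub>3 * (r\<^sub>1 + r\<^sub>2)) Y\<^sub>3)) s,
       poly (smult k\<^sub>1 Y\<^sub>1 + smult k\<^sub>2 Y\<^sub>2 + smult k\<^sub>3 Y\<^sub>3) s)" for s
      unfolding interp_def Let_def Y_def divide_inverse k[symmetric] by (simp add: mult_ac)
    then show ?thesis by blast
  qed
  then obtain X\<^sub>0 X\<^sub>1 X\<^sub>2 where interp_Y: "\<And>s. interp (Y s) = (poly X\<^sub>0 s, poly X\<^sub>1 s, poly X\<^sub>2 s)" by blast
  define V where "V = vec_of_list [X\<^sub>0, X\<^sub>1, X\<^sub>2, [:t, 0, 0, 1:]]"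
  define y where "y s = map_vec (\<lambda>q. poly q s) V" for s
  have y: "y s \<in> carrier_vec 4" "y s $ 0 = poly X\<^sub>0 s" "y s $ 1 = poly X\<^sub>1 s"
    "y s $ 2 = poly X\<^sub>2 s" "y s $ 3 = t + s ^ 3" for s
    using vec_of_list_4(1)[of X\<^sub>0 X\<^sub>1 X\<^sub>2 "[:t, 0, 0, 1:]"]
    by (simp_all add: y_def V_def vec_of_list_4(3-) power3_eq_cube carrier_vecI
        del: vec_of_list_Cons One_nat_def)
  have *: "mpoly_eval (\<lambda>c. c) (y s) p = poly (mpoly_eval (\<lambda>c. [:c:]) V p) s" for s
    unfolding y_def using p by (rule mpoly_eval_poly_vec) (simp only: V_def vec_of_list_4)
  have norm: "cnorm a b (y s $ 0, y s $ 1, y s $ 2) = poly f (y s $ 3)" for s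
  proof -
    have "cnorm a b (y s $ 0, y s $ 1, y s $ 2) = cnorm a b (interp (Y s))"
      by (simp only: y interp_Y)
    also have "\<dots> = poly (Y\<^sub>1 * Y\<^sub>2 * Y\<^sub>3) s"
      unfolding Y_def cnorm_eq_prod ceval_interp by simp
    also have "\<dots> = poly f (y s $ 3)" by (simp only: Y q y)
    finally show ?thesis .
  qed
  \<comment> \<open>Every element of \<open>T\<close> has the form \<open>t + s^3\<close> because
    cubing is onto, so \<open>S\<close> is infinite.\<close>
  define S where "S = {s. t + s ^ 3 \<in> T - {c. poly f c = 0}}"
  have "infinite S"
  proof
    assume "finite S"
    then have "finite ((\<lambda>s. t + s ^ 3) ` S)" by simp
    moreover have "T - {c. poly f c = 0} \<subseteq> (\<lambda>s. t + s ^ 3) ` S"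
    proof
      fix c assume c: "c \<in> T - {c. poly f c = 0}"
      obtain s where "s ^ 3 = c - t" using cubes by blast
      then have "t + s ^ 3 = c" by simp
      with c show "c \<in> (\<lambda>s. t + s ^ 3) ` S" unfolding S_def by blast
    qed
    ultimately have "finite (T - {c. poly f c = 0})" by (rule finite_subset[rotated])
    with T poly_roots_finite[OF f] show False by (simp add: Diff_infinite_finite)
  qed
  moreover have "poly (mpoly_eval (\<lambda>c. [:c:]) V p) s = 0" if "s \<in> S" for s
    unfolding *[symmetric] using that by (intro zero norm y) (auto simp: S_def y)
  ultimately have "mpoly_eval (\<lambda>c. [:c:]) V p = 0" by (rule poly_eq_0_if_infinite_zeros)
  then have "mpoly_eval (\<lambda>c. c) (y 0) p = 0" by (simp add: *)
  moreover have "y 0 = x"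
  proof (rule vec_4_eqI)
    \<comment> \<open>At \<open>s = 0\<close> the interpolated values are the conjugates of
      \<open>x'\<close> itself.\<close>
    have "interp (Y 0) = x'"
      by (rule ceval_inject) (simp_all only: Y_def ceval_interp Y)
    then show "y 0 $ 0 = x $ 0" "y 0 $ 1 = x $ 1" "y 0 $ 2 = x $ 2" "y 0 $ 3 = x $ 3"
      by (simp_all add: y interp_Y x'_def t_def del: One_nat_def)
  qed (use x y in simp_all)
  ultimately show ?thesis by simp
qed

text \<open>With finitely many values, some \<open>C\<close> is taken infinitely often, so
  \<open>M^2 = C E^3\<close> as polynomials in \<open>u\<close>. The coefficients of
  \<open>u^6\<close> and \<open>u^5\<close> give \<open>b^2 = C a^3\<close> and
  \<open>27 C = - 4\<close>, contradicting \<open>disc\<close>.\<close>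

lemma infinite_values_adj:
  fixes a b c :: "'c::field_char_0"
  assumes a: "a \<noteq> 0" and b: "b \<noteq> 0" and disc: "4 * a ^ 3 + 27 * b\<^sup>2 \<noteq> 0"
  shows "infinite ((\<lambda>u. (adj_norm a b u)\<^sup>2 / adj_trace a b u ^ 3) ` {u. adj_trace a b u \<noteq> 0})"
proof
  define E M where "E = [:- 3 * a\<^sup>2, 9 * b, a:]" and "M = [:2 * a ^ 3 + 27 * b\<^sup>2, 9 * a * b, 2 * a\<^sup>2, - b:]"
  have E: "poly E u = adj_trace a b u" and M: "poly M u = adj_norm a b u" for u
    by (simp_all add: E_def M_def adj_trace_def adj_norm_def) Groebner_Basis.algebra+
  let ?A = "{u. adj_trace a b u \<noteq> 0}" and ?g = "\<lambda>u. (adj_norm a b u)\<^sup>2 / adj_trace a b u ^ 3"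
  assume "finite (?g ` ?A)"
  moreover have "infinite ?A"
  proof -
    have "E \<noteq> 0" using a by (simp add: E_def)
    then have "finite {u. poly E u = 0}" by (rule poly_roots_finite)
    then have "infinite (UNIV - {u. poly E u = 0})"
      by (rule Diff_infinite_finite) (rule infinite_UNIV_char_0)
    moreover have "UNIV - {u. poly E u = 0} = ?A" by (auto simp: E)
    ultimately show ?thesis by simp
  qed
  ultimately obtain u\<^sub>0 where u: "infinite {u \<in> ?A. ?g u = ?g u\<^sub>0}"
    using pigeonhole_infinite[of ?A ?g] by blast
  define C where "C = ?g u\<^sub>0"
  have "M ^ 2 - smult C (E ^ 3) = 0"
    using u by (rule poly_eq_0_if_infinite_zeros) (auto simp: E M C_def[symmetric] field_simps)
  then have c: "coeff (M ^ 2 - smult C (E ^ 3)) i = 0" for i by simp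
  have 6: "b\<^sup>2 - C * a ^ 3 = 0"
    using c[of 6] by (simp add: E_def M_def eval_nat_numeral algebra_simps)
  have 5: "- 4 * a\<^sup>2 * b - C * (27 * a\<^sup>2 * b) = 0"
    using c[of 5] by (simp add: E_def M_def eval_nat_numeral algebra_simps)
  have "(4 + 27 * C) * (a\<^sup>2 * b) = 0" using 5 by Groebner_Basis.algebra
  with a b have "4 + 27 * C = 0" by simp
  with 6 have "4 * a ^ 3 + 27 * b\<^sup>2 = 0" by Groebner_Basis.algebra
  with disc show False by simp
qed

section \<open>The parametrisation\<close>

definition time_num :: "'a::comm_ring_1 \<Rightarrow> 'a \<Rightarrow> 'a \<Rightarrow> 'a \<Rightarrow> 'a \<Rightarrow> 'a"
  where "time_num a b a\<^sub>4 a\<^sub>0 u = a\<^sub>4 ^ 3 * (adj_norm a b u)\<^sup>2 - a\<^sub>0 * adj_trace a b u ^ 3"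

definition time_den :: "'a::comm_ring_1 \<Rightarrow> 'a \<Rightarrow> 'a \<Rightarrow> 'a \<Rightarrow> 'a"
  where "time_den a b a\<^sub>1 u = a\<^sub>1 * adj_trace a b u ^ 3"

text \<open>
  With \<open>c = a\<^sub>4 / tr(N(\<delta>) / \<delta>)\<close>, the norm of \<open>t\<^sup>2 + c N(\<delta>) / \<delta>\<close> is \<open>t\<^sup>6 + a\<^sub>4 t\<^sup>4 + c\<^sup>3 N(\<delta>)\<^sup>2\<close>. Equating
  this with \<open>f(t)\<close> leaves a linear equation for \<open>t\<close>, solved by \<open>time_num / time_den\<close>. Below,
  \<open>t\<^sup>2 + c N(\<delta>) / \<delta>\<close> is multiplied by \<open>time_den\<^sup>2\<close>.
\<close>

definition curve_point :: "'a::comm_ring_1 \<Rightarrow> 'a \<Rightarrow> 'a \<Rightarrow> 'a \<Rightarrow> 'a \<Rightarrow> 'a \<Rightarrow> 'a \<times> 'a \<times> 'a"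
  where "curve_point a b a\<^sub>4 a\<^sub>1 a\<^sub>0 u = caffine ((time_num a b a\<^sub>4 a\<^sub>0 u)\<^sup>2)
    (a\<^sub>4 * a\<^sub>1\<^sup>2 * adj_trace a b u ^ 5) (adj_point a b u)"

text \<open>\<open>z\<^sup>3 / N(z)\<close> is an element of norm 1, and over an algebraically closed field every such element
  is of this form.\<close>

definition point_num :: "'a::comm_ring_1 \<Rightarrow> 'a \<Rightarrow> 'a \<Rightarrow> 'a \<Rightarrow> 'a \<Rightarrow> 'a \<Rightarrow> 'a \<times> 'a \<times> 'a \<Rightarrow> 'a \<times> 'a \<times> 'a"
  where "point_num a b a\<^sub>4 a\<^sub>1 a\<^sub>0 u z = cmul a b (curve_point a b a\<^sub>4 a\<^sub>1 a\<^sub>0 u) (ccube a b z)"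

definition point_den :: "'a::comm_ring_1 \<Rightarrow> 'a \<Rightarrow> 'a \<Rightarrow> 'a \<Rightarrow> 'a \<times> 'a \<times> 'a \<Rightarrow> 'a"
  where "point_den a b a\<^sub>1 u z = (time_den a b a\<^sub>1 u)\<^sup>2 * cnorm a b z"

context comm_ring_hom
begin

lemma hom_time_num: "hom (time_num a b a\<^sub>4 a\<^sub>0 u) = time_num (hom a) (hom b) (hom a\<^sub>4) (hom a\<^sub>0) (hom u)"
  by (simp add: time_num_def hom_distribs hom_adj_trace hom_adj_norm)

lemma hom_time_den: "hom (time_den a b a\<^sub>1 u) = time_den (hom a) (hom b) (hom a\<^sub>1) (hom u)"
  by (simp add: time_den_def hom_distribs hom_adj_trace)

lemma hom_point_num:
  "cmap hom (point_num a b a\<^sub>4 a\<^sub>1 a\<^sub>0 u z) =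
    point_num (hom a) (hom b) (hom a\<^sub>4) (hom a\<^sub>1) (hom a\<^sub>0) (hom u) (cmap hom z)"
  by (simp add: point_num_def curve_point_def hom_cmul hom_ccube hom_caffine hom_adj_point
      hom_adj_trace hom_time_num hom_distribs)

lemma hom_point_den:
  "hom (point_den a b a\<^sub>1 u z) = point_den (hom a) (hom b) (hom a\<^sub>1) (hom u) (cmap hom z)"
  by (simp add: point_den_def hom_cnorm hom_time_den hom_distribs)

end

text \<open>Scaling by \<open>D^2\<close> multiplies the norm by \<open>D^6\<close>. The choice of
  \<open>N\<close> gives \<open>a\<^sub>4^3 M^2 = N + a\<^sub>0 E^3\<close>, which turns the last
  summand of \<open>cnorm_adj_point\<close> into
  \<open>a\<^sub>1 N D^5 + a\<^sub>0 D^6\<close>.\<close>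

lemma cnorm_curve_point:
  fixes a b a\<^sub>4 a\<^sub>1 a\<^sub>0 u :: "'c::field"
  assumes "a\<^sub>1 \<noteq> 0" "adj_trace a b u \<noteq> 0"
  shows "cnorm a b (curve_point a b a\<^sub>4 a\<^sub>1 a\<^sub>0 u) = time_den a b a\<^sub>1 u ^ 6 *
    poly [:a\<^sub>0, a\<^sub>1, 0, 0, a\<^sub>4, 0, 1:] (time_num a b a\<^sub>4 a\<^sub>0 u / time_den a b a\<^sub>1 u)"
proof -
  define N D E M where "N = time_num a b a\<^sub>4 a\<^sub>0 u" and "D = time_den a b a\<^sub>1 u"
    and "E = adj_trace a b u" and "M = adj_norm a b u"
  have N: "N = a\<^sub>4 ^ 3 * M\<^sup>2 - a\<^sub>0 * E ^ 3" and D: "D = a\<^sub>1 * E ^ 3" and "D \<noteq> 0"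
    using assms by (simp_all add: N_def D_def E_def M_def time_num_def time_den_def)
  define s where "s = N / D"
  have s: "s * D = N" using \<open>D \<noteq> 0\<close> by (simp add: s_def)
  have "cnorm a b (curve_point a b a\<^sub>4 a\<^sub>1 a\<^sub>0 u) =
      (N\<^sup>2) ^ 3 + (N\<^sup>2)\<^sup>2 * (a\<^sub>4 * a\<^sub>1\<^sup>2 * E ^ 5) * E + (a\<^sub>4 * a\<^sub>1\<^sup>2 * E ^ 5) ^ 3 * M\<^sup>2"
    unfolding curve_point_def cnorm_adj_point N_def E_def M_def ..
  also have "\<dots> = N ^ 6 + a\<^sub>4 * N ^ 4 * D\<^sup>2 + a\<^sub>1 * N * D ^ 5 + a\<^sub>0 * D ^ 6"
  proof -
    have "a\<^sub>4 ^ 3 * M\<^sup>2 = N + a\<^sub>0 * E ^ 3" by (simp add: N)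
    moreover have "(a\<^sub>4 * a\<^sub>1\<^sup>2 * E ^ 5) ^ 3 * M\<^sup>2 = (a\<^sub>4 ^ 3 * M\<^sup>2) * (a\<^sub>1 ^ 6 * E ^ 15)"
      by Groebner_Basis.algebra
    ultimately have *: "(a\<^sub>4 * a\<^sub>1\<^sup>2 * E ^ 5) ^ 3 * M\<^sup>2 = (N + a\<^sub>0 * E ^ 3) * (a\<^sub>1 ^ 6 * E ^ 15)"
      by (simp only:)
    show ?thesis unfolding * D by Groebner_Basis.algebra
  qed
  also have "\<dots> = D ^ 6 * (s ^ 6 + a\<^sub>4 * s ^ 4 + a\<^sub>1 * s + a\<^sub>0)"
    unfolding s[symmetric] by Groebner_Basis.algebra
  also have "s ^ 6 + a\<^sub>4 * s ^ 4 + a\<^sub>1 * s + a\<^sub>0 = poly [:a\<^sub>0, a\<^sub>1, 0, 0, a\<^sub>4, 0, 1:] s"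
    by (simp add: eval_nat_numeral algebra_simps)
  finally show ?thesis unfolding s_def N_def D_def .
qed

section \<open>Moving along the fibres by elements of norm 1\<close>

context split_cubic
begin

lemma cnorm_cmul: "cnorm a b (cmul a b x y) = cnorm a b x * cnorm a b y"
  by (simp add: cnorm_eq_prod ceval_cmul roots)

lemma cnorm_ccube: "cnorm a b (ccube a b x) = cnorm a b x ^ 3"
  by (simp add: cnorm_eq_prod ceval_ccube roots power_mult_distrib)

lemma cnorm_scale: "cnorm a b (cmap (\<lambda>y. y / c) x) = cnorm a b x / c ^ 3"
proof -
  have "ceval r (cmap (\<lambda>y. y / c) x) = ceval r x / c" for r
    by (cases x) (simp add: add_divide_distrib)
  then show ?thesis by (simp add: cnorm_eq_prod power3_eq_cube)
qed

text \<open>The factor \<open>D^6\<close> of the curve point and the cube of the norm of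
  \<open>z\<close> cancel against the third power of the common denominator.\<close>

lemma cnorm_point:
  assumes "a\<^sub>1 \<noteq> 0" "adj_trace a b u \<noteq> 0" "cnorm a b z \<noteq> 0"
  shows "cnorm a b (cmap (\<lambda>y. y / point_den a b a\<^sub>1 u z) (point_num a b a\<^sub>4 a\<^sub>1 a\<^sub>0 u z)) =
    poly [:a\<^sub>0, a\<^sub>1, 0, 0, a\<^sub>4, 0, 1:] (time_num a b a\<^sub>4 a\<^sub>0 u / time_den a b a\<^sub>1 u)"
proof -
  define v where "v = poly [:a\<^sub>0, a\<^sub>1, 0, 0, a\<^sub>4, 0, 1:] (time_num a b a\<^sub>4 a\<^sub>0 u / time_den a b a\<^sub>1 u)"
  have "time_den a b a\<^sub>1 u \<noteq> 0" using assms by (simp add: time_den_def)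
  then show ?thesis
    unfolding cnorm_scale point_num_def point_den_def cnorm_cmul cnorm_ccube
      cnorm_curve_point[OF assms(1,2)] v_def[symmetric]
    using assms(3) by (simp add: field_simps flip: power_mult)
qed

text \<open>The quotient of \<open>x\<close> by the curve point over the same \<open>t\<close> has
  norm 1, as both have norm \<open>f(t)\<close>. Its conjugates have cube roots, so it equals
  \<open>z^3\<close> with \<open>z\<close> of norm 1. For the quotient to exist, \<open>f(t)\<close>
  must be nonzero.\<close>

lemma point_surj:
  assumes "a\<^sub>1 \<noteq> 0" "adj_trace a b u \<noteq> 0"
    and cubes: "\<And>t. \<exists>s::'c. s ^ 3 = t"
    and t: "t = time_num a b a\<^sub>4 a\<^sub>0 u / time_den a b a\<^sub>1 u"
    and x: "cnorm a b x = poly [:a\<^sub>0, a\<^sub>1, 0, 0, a\<^sub>4, 0, 1:] t"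
    and nz: "poly [:a\<^sub>0, a\<^sub>1, 0, 0, a\<^sub>4, 0, 1:] t \<noteq> 0"
  shows "\<exists>z. cnorm a b z = 1 \<and>
    cmap (\<lambda>y. y / point_den a b a\<^sub>1 u z) (point_num a b a\<^sub>4 a\<^sub>1 a\<^sub>0 u z) = x"
proof -
  define D where "D = time_den a b a\<^sub>1 u"
  define p where "p = curve_point a b a\<^sub>4 a\<^sub>1 a\<^sub>0 u"
  have "D \<noteq> 0" using assms by (simp add: D_def time_den_def)
  have p: "cnorm a b p = D ^ 6 * cnorm a b x"
    unfolding p_def D_def x t by (rule cnorm_curve_point[OF assms(1,2)])
  \<comment> \<open>These are the conjugates of \<open>x\<close> divided by \<open>p / D^2\<close>,
    the point of the curve before clearing denominators.\<close>
  define w where "w r = D\<^sup>2 * ceval r x / ceval r p" for r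
  have px: "cnorm a b p \<noteq> 0" "cnorm a b x \<noteq> 0"
    using p \<open>D \<noteq> 0\<close> nz x by auto
  have p0: "ceval r\<^sub>1 p \<noteq> 0" "ceval r\<^sub>2 p \<noteq> 0" "ceval r\<^sub>3 p \<noteq> 0"
    using px(1) by (auto simp: cnorm_eq_prod)
  have w: "w r\<^sub>1 * w r\<^sub>2 * w r\<^sub>3 = 1"
  proof -
    have "w r\<^sub>1 * w r\<^sub>2 * w r\<^sub>3 = D ^ 6 * cnorm a b x / cnorm a b p"
      unfolding w_def cnorm_eq_prod by (simp add: field_simps eval_nat_numeral)
    then show ?thesis using px p by simp
  qed
  obtain s\<^sub>1 s\<^sub>2 where s: "s\<^sub>1 ^ 3 = w r\<^sub>1" "s\<^sub>2 ^ 3 = w r\<^sub>2" using cubes by metis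
  have s0: "s\<^sub>1 \<noteq> 0" "s\<^sub>2 \<noteq> 0" using s w by auto
  \<comment> \<open>The third value is forced by the other two so that \<open>z\<close> has norm
    exactly 1; an arbitrary cube root could give another cube root of unity.\<close>
  define z where "z = interp (s\<^sub>1, s\<^sub>2, 1 / (s\<^sub>1 * s\<^sub>2))"
  have z: "ceval r\<^sub>1 z = s\<^sub>1" "ceval r\<^sub>2 z = s\<^sub>2" "ceval r\<^sub>3 z = 1 / (s\<^sub>1 * s\<^sub>2)"
    unfolding z_def by (rule ceval_interp)+
  have s3: "(1 / (s\<^sub>1 * s\<^sub>2)) ^ 3 = w r\<^sub>3"
  proof -
    have "w r\<^sub>1 * w r\<^sub>2 \<noteq> 0" using w by auto
    then have "w r\<^sub>3 = 1 / (w r\<^sub>1 * w r\<^sub>2)" using w by (simp add: eq_divide_eq mult_ac)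
    then show ?thesis by (simp add: power_divide power_mult_distrib s)
  qed
  have z1: "cnorm a b z = 1" using s0 by (simp add: cnorm_eq_prod z)
  have ev: "ceval r (cmap (\<lambda>y. y / c) y) = ceval r y / c" for r c and y :: "'c \<times> 'c \<times> 'c"
    by (cases y) (simp add: add_divide_distrib)
  have "cmap (\<lambda>y. y / point_den a b a\<^sub>1 u z) (point_num a b a\<^sub>4 a\<^sub>1 a\<^sub>0 u z) = x"
    using p0 \<open>D \<noteq> 0\<close>
    by (intro ceval_inject)
      (simp_all add: ev point_num_def point_den_def ceval_cmul ceval_ccube roots z s s3 z1
        w_def D_def[symmetric] p_def[symmetric])
  with z1 show ?thesis by blast
qed

end

section \<open>Multivariate polynomials\<close>

lemma mpolys_mconst: "mconst c \<in> mpolys n"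
  by (auto simp: mpolys_def mconst_def keys_single split: if_splits)

lemma mpolys_mvar: "i < n \<Longrightarrow> mvar i \<in> mpolys n"
  by (auto simp: mpolys_def mvar_def keys_single split: if_splits)

lemma mpolys_add: "p \<in> mpolys n \<Longrightarrow> q \<in> mpolys n \<Longrightarrow> p + q \<in> mpolys n"
  using keys_add[of p q] by (auto simp: mpolys_def)

lemma mpolys_uminus: "p \<in> mpolys n \<Longrightarrow> - p \<in> mpolys n" for p :: "'a::comm_ring_1 mpoly"
  by (simp add: mpolys_def)

lemma mpolys_diff: "p \<in> mpolys n \<Longrightarrow> q \<in> mpolys n \<Longrightarrow> p - q \<in> mpolys n"
  for p q :: "'a::comm_ring_1 mpoly"
  using mpolys_add[of p n "- q"] mpolys_uminus[of q n] by simp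

lemma mpolys_mult:
  fixes p q :: "'a::comm_ring_1 mpoly"
  assumes "p \<in> mpolys n" "q \<in> mpolys n"
  shows "p * q \<in> mpolys n"
  unfolding mpolys_def
proof (rule CollectI, rule ballI)
  fix m assume "m \<in> Poly_Mapping.keys (p * q)"
  then obtain m\<^sub>1 m\<^sub>2 where m: "m = m\<^sub>1 + m\<^sub>2" "m\<^sub>1 \<in> Poly_Mapping.keys p" "m\<^sub>2 \<in> Poly_Mapping.keys q"
    using keys_mult[of p q] by blast
  then have "Poly_Mapping.keys m\<^sub>1 \<union> Poly_Mapping.keys m\<^sub>2 \<subseteq> {..<n}"
    using assms unfolding mpolys_def by blast
  then show "Poly_Mapping.keys m \<subseteq> {..<n}"
    unfolding m(1) by (rule order_trans[OF keys_add])
qed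

lemma mpolys_numeral:
  "(numeral k :: 'a::comm_ring_1 mpoly) \<in> mpolys n" "(1 :: 'a mpoly) \<in> mpolys n"
proof -
  show 1: "(1 :: 'a mpoly) \<in> mpolys n" using mpolys_mconst[of "1 :: 'a"] by (simp add: mconst_simps)
  show "(numeral k :: 'a mpoly) \<in> mpolys n"
    by (induction k) (simp_all only: numeral.simps 1 mpolys_add)
qed

lemma mpolys_power: "p \<in> mpolys n \<Longrightarrow> p ^ k \<in> mpolys n" for p :: "'a::comm_ring_1 mpoly"
  by (induction k) (simp_all only: power.simps mpolys_numeral mpolys_mult)

lemmas mpolys_intros = mpolys_mconst mpolys_mvar mpolys_add mpolys_uminus mpolys_diff mpolys_mult
  mpolys_numeral mpolys_power

lemma mpolys_cmul:
  assumes "a \<in> mpolys n" "b \<in> mpolys n"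
    and "x \<in> mpolys n \<times> mpolys n \<times> mpolys n" "y \<in> mpolys n \<times> mpolys n \<times> mpolys n"
  shows "cmul a b x y \<in> mpolys n \<times> mpolys n \<times> mpolys n"
  using assms by (cases x; cases y) (auto intro!: mpolys_add mpolys_diff mpolys_mult)

lemma mpolys_caffine:
  assumes "s \<in> mpolys n" "c \<in> mpolys n" "x \<in> mpolys n \<times> mpolys n \<times> mpolys n"
  shows "caffine s c x \<in> mpolys n \<times> mpolys n \<times> mpolys n"
  using assms by (cases x) (auto intro!: mpolys_add mpolys_mult)

lemma comm_ring_hom_to_ac: "comm_ring_hom to_ac"
  by unfold_locales simp_all

section \<open>The hypersurface in coordinates and the discriminant of \<open>h\<close>\<close>

lemma norm_hypersurface_iff:
  fixes a b a\<^sub>4 a\<^sub>1 a\<^sub>0 :: "'k::field" and \<alpha> :: "'k alg_closure"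
  assumes irr: "irreducible [:b, a, 0, 1:]" and root: "\<alpha> ^ 3 + to_ac a * \<alpha> + to_ac b = 0"
  shows "x \<in> norm_hypersurface (adjoin \<alpha>) \<alpha> [:a\<^sub>0, a\<^sub>1, 0, 0, a\<^sub>4, 0, 1:] \<longleftrightarrow> x \<in> carrier_vec 4 \<and>
    cnorm (to_ac a) (to_ac b) (x $ 0, x $ 1, x $ 2) =
      poly [:to_ac a\<^sub>0, to_ac a\<^sub>1, 0, 0, to_ac a\<^sub>4, 0, 1:] (x $ 3)"
proof -
  interpret comm_ring_hom "mpoly_eval to_ac x"
    by (rule comm_ring_hom_mpoly_eval) (rule comm_ring_hom_to_ac)
  have const: "mpoly_eval to_ac x (mconst c) = to_ac c" for c
    by (simp add: mpoly_eval_mconst)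
  have var: "mpoly_eval to_ac x (mvar i) = x $ i" for i
    by (simp add: mpoly_eval_mvar)
  have "mpoly_eval to_ac x (norm_form (adjoin \<alpha>) [1, \<alpha>, \<alpha>\<^sup>2]) =
      cnorm (to_ac a) (to_ac b) (x $ 0, x $ 1, x $ 2)"
    unfolding norm_form_cubic[OF irr root] Let_def by (simp add: hom_distribs const var)
  moreover have "mpoly_eval to_ac x (poly (map_poly mconst [:a\<^sub>0, a\<^sub>1, 0, 0, a\<^sub>4, 0, 1:]) (mvar 3)) =
      poly [:to_ac a\<^sub>0, to_ac a\<^sub>1, 0, 0, to_ac a\<^sub>4, 0, 1:] (x $ 3)"
    by (simp add: map_poly_pCons mconst_simps hom_distribs const var)
  ultimately show ?thesis
    unfolding norm_hypersurface_def zero_locus_def by (simp add: hom_distribs)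
qed

lemma irreducible_imp_no_root:
  fixes h :: "'a::field poly"
  assumes "irreducible h" "degree h > 1"
  shows "poly h c \<noteq> 0"
proof
  assume "poly h c = 0"
  then have "[:- c, 1:] dvd h" by (simp add: poly_eq_0_iff_dvd)
  with irreducibleD'[OF assms(1)] have "h dvd [:- c, 1:] \<or> is_unit [:- c, 1:]" by blast
  then have "degree h \<le> 1"
  proof
    assume "h dvd [:- c, 1:]"
    then have "degree h \<le> degree [:- c, 1:]" by (rule dvd_imp_degree_le) simp
    then show ?thesis by simp
  qed (simp add: is_unit_iff_degree)
  with assms(2) show False by simp
qed

text \<open>An irreducible cubic has no root in the field, whereas 0 would be a root if
  \<open>b = 0\<close>, and \<open>3 * b / a\<close> if the discriminant vanished.\<close>

lemma irreducible_cubic_discriminant: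
  fixes a b :: "'a::field_char_0"
  assumes "irreducible [:b, a, 0, 1:]" "a \<noteq> 0"
  shows "b \<noteq> 0" "4 * a ^ 3 + 27 * b\<^sup>2 \<noteq> 0"
proof -
  have *: "poly [:b, a, 0, 1:] c \<noteq> 0" for c
    using assms(1) by (rule irreducible_imp_no_root) simp
  from *[of 0] show "b \<noteq> 0" by simp
  show "4 * a ^ 3 + 27 * b\<^sup>2 \<noteq> 0"
  proof
    assume disc: "4 * a ^ 3 + 27 * b\<^sup>2 = 0"
    \<comment> \<open>With a double root r one has a = - 3 r^2 and b = 2 r^3, so
      \<open>3 * b / a\<close> is the remaining root - 2 r.\<close>
    have "a ^ 3 * poly [:b, a, 0, 1:] (3 * b / a) = b * (4 * a ^ 3 + 27 * b\<^sup>2)"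
      using assms(2) by (simp add: field_simps eval_nat_numeral)
    then have "a ^ 3 * poly [:b, a, 0, 1:] (3 * b / a) = 0" by (simp only: disc mult_zero_right)
    moreover have "a ^ 3 \<noteq> 0" using assms(2) by simp
    ultimately show False using *[of "3 * b / a"] by (metis mult_eq_0_iff)
  qed
qed

theorem theorem3p1:
  fixes a b a\<^sub>4 a\<^sub>1 a\<^sub>0 :: "'k::field_char_0"
    and \<alpha> :: "'k alg_closure"
    and K :: "'k alg_closure set"
    and h f :: "'k poly"
  assumes "a \<noteq> 0"
    and "h = [:b, a, 0, 1:]"
    and "irreducible h"
    and "\<alpha> ^ 3 + to_ac a * \<alpha> + to_ac b = 0"
    and "K = adjoin \<alpha>"
    and "f = [:a\<^sub>0, a\<^sub>1, 0, 0, a\<^sub>4, 0, 1:]"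
    and "a\<^sub>1 * a\<^sub>4 \<noteq> 0"
  shows "unirational 4 (norm_hypersurface K \<alpha> f)"
proof -
  define a' b' a\<^sub>4' a\<^sub>1' a\<^sub>0' where defs': "a' = to_ac a" "b' = to_ac b" "a\<^sub>4' = to_ac a\<^sub>4"
    "a\<^sub>1' = to_ac a\<^sub>1" "a\<^sub>0' = to_ac a\<^sub>0"
  define f' where "f' = [:a\<^sub>0', a\<^sub>1', 0, 0, a\<^sub>4', 0, 1:]"
  define V where "V = norm_hypersurface K \<alpha> f"
  have irr: "irreducible [:b, a, 0, 1:]" using assms by simp
  have nz: "a' \<noteq> 0" "a\<^sub>1' \<noteq> 0" "a\<^sub>4' \<noteq> 0" using assms by (auto simp: defs')
  have V: "x \<in> V \<longleftrightarrow> x \<in> carrier_vec 4 \<and> cnorm a' b' (x $ 0, x $ 1, x $ 2) = poly f' (x $ 3)" for x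
    unfolding V_def f'_def defs' assms(5,6) by (rule norm_hypersurface_iff[OF irr assms(4)])
  have b: "b' \<noteq> 0" using irreducible_cubic_discriminant(1)[OF irr assms(1)] by (simp add: defs')
  have disc: "4 * a' ^ 3 + 27 * b'\<^sup>2 \<noteq> 0"
  proof -
    have "4 * a' ^ 3 + 27 * b'\<^sup>2 = to_ac (4 * a ^ 3 + 27 * b\<^sup>2)" by (simp add: defs')
    then show ?thesis using irreducible_cubic_discriminant(2)[OF irr assms(1)]
      by (simp only: to_ac_eq_0_iff not_False_eq_True)
  qed
  obtain r\<^sub>2 r\<^sub>3 where "split_cubic a' b' \<alpha> r\<^sub>2 r\<^sub>3"
    using split_cubic_exists[OF _ disc, of \<alpha>] assms(4) by (auto simp: defs')
  then interpret split_cubic a' b' \<alpha> r\<^sub>2 r\<^sub>3 .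
  have cubes: "\<exists>s. s ^ 3 = t" for t :: "'k alg_closure"
    using nth_root_exists[of 3 t] by auto
  let ?t = "\<lambda>u. time_num a' b' a\<^sub>4' a\<^sub>0' u / time_den a' b' a\<^sub>1' u"
  let ?X = "\<lambda>u z. cmap (\<lambda>y. y / point_den a' b' a\<^sub>1' u z) (point_num a' b' a\<^sub>4' a\<^sub>1' a\<^sub>0' u z)"

  \<comment> \<open>The rational map and its image\<close>
  define Z :: "'k mpoly \<times> 'k mpoly \<times> 'k mpoly" where "Z = (mvar 1, mvar 2, mvar 3)"
  define P where "P = point_num (mconst a) (mconst b) (mconst a\<^sub>4) (mconst a\<^sub>1) (mconst a\<^sub>0) (mvar 0) Z"
  define Q where "Q = point_den (mconst a) (mconst b) (mconst a\<^sub>1) (mvar 0) Z"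
  define N where "N = time_num (mconst a) (mconst b) (mconst a\<^sub>4) (mconst a\<^sub>0) (mvar 0)"
  define D where "D = time_den (mconst a) (mconst b) (mconst a\<^sub>1) (mvar 0)"
  \<comment> \<open>Variable 0 is the parameter \<open>u\<close> of the curve, and variables 1, 2, 3
    are the coordinates of \<open>z\<close>.\<close>
  define F where "F = [(fst P, Q), (fst (snd P), Q), (snd (snd P), Q), (N, D)]"
  have eval: "mpoly_eval to_ac v N = time_num a' b' a\<^sub>4' a\<^sub>0' (v $ 0)"
      "mpoly_eval to_ac v D = time_den a' b' a\<^sub>1' (v $ 0)"
      "mpoly_eval to_ac v Q = point_den a' b' a\<^sub>1' (v $ 0) (v $ 1, v $ 2, v $ 3)"
      "cmap (mpoly_eval to_ac v) P = point_num a' b' a\<^sub>4' a\<^sub>1' a\<^sub>0' (v $ 0) (v $ 1, v $ 2, v $ 3)" for v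
  proof -
    interpret ev: comm_ring_hom "mpoly_eval to_ac v"
      by (rule comm_ring_hom_mpoly_eval) (rule comm_ring_hom_to_ac)
    show "mpoly_eval to_ac v N = time_num a' b' a\<^sub>4' a\<^sub>0' (v $ 0)"
      "mpoly_eval to_ac v D = time_den a' b' a\<^sub>1' (v $ 0)"
      "mpoly_eval to_ac v Q = point_den a' b' a\<^sub>1' (v $ 0) (v $ 1, v $ 2, v $ 3)"
      "cmap (mpoly_eval to_ac v) P = point_num a' b' a\<^sub>4' a\<^sub>1' a\<^sub>0' (v $ 0) (v $ 1, v $ 2, v $ 3)"
      by (simp_all add: N_def D_def Q_def P_def Z_def defs' ev.hom_time_num ev.hom_time_den
          ev.hom_point_den ev.hom_point_num mpoly_eval_mconst mpoly_eval_mvar)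
  qed
  have apply_F: "ratmap_apply F v \<in> carrier_vec 4" "ratmap_apply F v $ 3 = ?t (v $ 0)"
      "(ratmap_apply F v $ 0, ratmap_apply F v $ 1, ratmap_apply F v $ 2) =
        ?X (v $ 0) (v $ 1, v $ 2, v $ 3)" for v
    unfolding eval[symmetric]
    by (cases P; simp add: ratmap_apply_def F_def vec_of_list_4
        del: vec_of_list_Cons vec_of_list_map One_nat_def)+
  have domain: "v \<in> ratmap_domain 4 F \<longleftrightarrow> v \<in> carrier_vec 4 \<and> adj_trace a' b' (v $ 0) \<noteq> 0 \<and>
      cnorm a' b' (v $ 1, v $ 2, v $ 3) \<noteq> 0" for v
    using nz by (auto simp: ratmap_domain_def F_def eval time_den_def point_den_def
        simp del: cnorm.simps)
  have image: "ratmap_apply F v \<in> V" if "v \<in> ratmap_domain 4 F" for v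
    using that cnorm_point[OF nz(2)] unfolding V apply_F f'_def domain by (auto simp: apply_F(1))

  \<comment> \<open>Covering the fibres over infinitely many values of t\<close>
  define T where "T = ?t ` {u. adj_trace a' b' u \<noteq> 0}"
  have "infinite T"
  proof
    assume "finite T"
    let ?g = "\<lambda>u. (adj_norm a' b' u)\<^sup>2 / adj_trace a' b' u ^ 3"
    \<comment> \<open>As \<open>?g\<close> is an affine function of \<open>?t\<close>, finiteness of
      \<open>T\<close> would contradict \<open>infinite_values_adj\<close>.\<close>
    have "?g u = (a\<^sub>1' * ?t u + a\<^sub>0') / a\<^sub>4' ^ 3" if "adj_trace a' b' u \<noteq> 0" for u
      using that nz by (simp add: time_num_def time_den_def field_simps)
    then have "?g ` {u. adj_trace a' b' u \<noteq> 0} = (\<lambda>t. (a\<^sub>1' * t + a\<^sub>0') / a\<^sub>4' ^ 3) ` T"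
      unfolding T_def image_image by (intro image_cong) auto
    with \<open>finite T\<close> infinite_values_adj[OF nz(1) b disc] show False by simp
  qed
  have surj: "\<exists>v \<in> ratmap_domain 4 F. ratmap_apply F v = x"
    if x: "x \<in> carrier_vec 4" "x $ 3 \<in> T" "poly f' (x $ 3) \<noteq> 0"
      "cnorm a' b' (x $ 0, x $ 1, x $ 2) = poly f' (x $ 3)" for x
  proof -
    obtain u where u: "adj_trace a' b' u \<noteq> 0" "x $ 3 = ?t u" using x(2) by (auto simp: T_def)
    obtain z where z: "cnorm a' b' z = 1" "?X u z = (x $ 0, x $ 1, x $ 2)"
      using point_surj[OF nz(2) u(1) cubes u(2) x(4)[unfolded f'_def] x(3)[unfolded f'_def]] by blast
    obtain z\<^sub>1 z\<^sub>2 z\<^sub>3 where z': "z = (z\<^sub>1, z\<^sub>2, z\<^sub>3)" by (cases z)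
    define v where "v = vec_of_list [u, z\<^sub>1, z\<^sub>2, z\<^sub>3]"
    have v: "v $ 0 = u" "v $ 1 = z\<^sub>1" "v $ 2 = z\<^sub>2" "v $ 3 = z\<^sub>3" "v \<in> carrier_vec 4"
      unfolding v_def by (rule vec_of_list_4)+
    have "v \<in> ratmap_domain 4 F"
      unfolding domain v using u z v z' by simp
    moreover have "ratmap_apply F v = x"
      using apply_F(2,3)[of v] z(2) u(2) unfolding v z'
      by (intro vec_4_eqI apply_F x(1)) simp_all
    ultimately show ?thesis by blast
  qed

  \<comment> \<open>Zariski density of the image\<close>
  have "x \<in> zariski_closure 4 (ratmap_apply F ` ratmap_domain 4 F)" if "x \<in> V" for x
    unfolding zariski_closure_def
  proof (intro InterI, clarify)
    fix W assume W: "zariski_closed 4 W" "ratmap_apply F ` ratmap_domain 4 F \<subseteq> W"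
    then obtain S where S: "S \<subseteq> mpolys 4" "W = zero_locus (\<lambda>c. c) 4 S"
      by (auto simp: zariski_closed_def)
    have "mpoly_eval (\<lambda>c. c) x p = 0" if "p \<in> S" for p
    proof (rule mpoly_eval_zero_on_hypersurface[OF _ \<open>infinite T\<close>])
      show "p \<in> mpolys 4" using S that by blast
      show "f' \<noteq> 0" by (simp add: f'_def)
      show "\<exists>s::'k alg_closure. s ^ 3 = t" for t by (rule cubes)
      show "x \<in> carrier_vec 4" "cnorm a' b' (x $ 0, x $ 1, x $ 2) = poly f' (x $ 3)"
        using \<open>x \<in> V\<close> by (simp_all add: V del: cnorm.simps)
      fix y assume "y \<in> carrier_vec 4" "y $ 3 \<in> T" "poly f' (y $ 3) \<noteq> 0"
        "cnorm a' b' (y $ 0, y $ 1, y $ 2) = poly f' (y $ 3)"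
      then have "y \<in> ratmap_apply F ` ratmap_domain 4 F" using surj by blast
      with W S that show "mpoly_eval (\<lambda>c. c) y p = 0" by (auto simp: zero_locus_def)
    qed
    with \<open>x \<in> V\<close> show "x \<in> W" by (simp add: S zero_locus_def V del: cnorm.simps)
  qed
  moreover have "is_rational_map 4 4 F"
  proof -
    obtain t where "t \<in> T" using \<open>infinite T\<close> infinite_imp_nonempty by blast
    then obtain u where u: "adj_trace a' b' u \<noteq> 0" by (auto simp: T_def)
    \<comment> \<open>A single point of the domain, with \<open>z = 1\<close>, shows that the
      denominators are nonzero polynomials.\<close>
    have "vec_of_list [u, 1, 0, 0] \<in> ratmap_domain 4 F"
      unfolding domain using u by (simp add: vec_of_list_4 del: vec_of_list_Cons One_nat_def)
    then have "Q \<noteq> 0" "D \<noteq> 0"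
      by (auto simp: ratmap_domain_def F_def mpoly_eval_0)
    moreover have "Q \<in> mpolys 4" "D \<in> mpolys 4" "N \<in> mpolys 4"
      unfolding Q_def D_def N_def point_den_def time_den_def time_num_def adj_trace_def adj_norm_def
        Z_def cnorm.simps
      by (intro mpolys_intros; simp)+
    moreover have "P \<in> mpolys 4 \<times> mpolys 4 \<times> mpolys 4"
      unfolding P_def point_num_def curve_point_def ccube_def Z_def time_num_def adj_trace_def
        adj_norm_def adj_point_def
      by (intro mpolys_cmul mpolys_caffine SigmaI mpolys_intros; simp)
    then have "fst P \<in> mpolys 4" "fst (snd P) \<in> mpolys 4" "snd (snd P) \<in> mpolys 4"
      by auto
    ultimately show ?thesis by (simp add: is_rational_map_def F_def)
  qed
  ultimately show ?thesis
    unfolding unirational_def dominant_ratmap_def V_def[symmetric] using image by blast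
qed

end
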